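(* Let $X_1,X_2$ be nonempty compact metric spaces, $\phi_i\colon\mathbb{T}^+\times X_i\to X_i$ ($i=1,2$) dynamical systems, and $\Phi=\phi_1\times\phi_2$ the product system. Let $L_1=\{A_1\times\mathrm{Inv}(X_2)\mid A_1\in\mathsf{Att}(\phi_1)\}$ and $L_2=\{\mathrm{Inv}(X_1)\times A_2\mid A_2\in\mathsf{Att}(\phi_2)\}$, let $L_\wedge=\{A_1\times A_2\mid A_i\in\mathsf{Att}(\phi_i)\}$, and let $L_\wedge^\vee$ be the closure of $L_\wedge$ under finite joins in $\mathsf{Att}(\Phi)$. Then $$L_\wedge^\vee\;\cong\;L_1\amalg L_2\;\cong\;\mathsf{Att}(\phi_1)\amalg\mathsf{Att}(\phi_2),$$ where $\amalg$ is the coproduct in the category of bounded distributive lattices.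
   Context: $\mathbb{T}$ is $\mathbb{Z}$ or $\mathbb{R}$, $\mathbb{T}^+$ its nonnegative part. A dynamical system on a compact metric space $X$ is a continuous map $\phi\colon\mathbb{T}^+\times X\to X$ with $\phi(0,x)=x$, $\phi(t,\phi(s,x))=\phi(t+s,x)$ (not assumed injective or surjective). The product system is $\Phi(t,(x_1,x_2))=(\phi_1(t,x_1),\phi_2(t,x_2))$. $S$ is invariant if $\phi(t,S)=S$ for all $t\ge0$; $\mathrm{Inv}(U)$ is the union of all invariant subsets of $U$. $\omega(U)=\bigcap_{t\ge0}\mathrm{cl}(\phi([t,\infty),U))$. $U$ is an attracting neighborhood if there is $\tau>0$ with $\phi(t,\mathrm{cl}(U))\subset\mathrm{int}(U)$ for all $t\ge\tau$; an attractor is $\omega(U)$ ($=\mathrm{Inv}(U)$) for an attracting neighborhood $U$. $\mathsf{Att}(\phi)$ is the bounded distributive lattice of attractors with $A\vee B=A\cup B$, $A\wedge B=\omega(A\cap B)=\mathrm{Inv}(A\cap B)$, minimum $\emptyset$, maximum $\mathrm{Inv}(X)$. All sets in $L_1,L_2,L_\wedge$ are attractors of $\Phi$. Morphisms of bounded distributive lattices preserve $\vee,\wedge$, minimum and maximum. *)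

theory Defs
  imports "HOL-Analysis.Analysis"
begin

section \<open>Bounded distributive lattices\<close>

record 'a blattice =
  carrier :: "'a set"
  join :: "'a \<Rightarrow> 'a \<Rightarrow> 'a" (infixl "\<squnion>\<index>" 65)
  meet :: "'a \<Rightarrow> 'a \<Rightarrow> 'a" (infixl "\<sqinter>\<index>" 70)
  least :: 'a ("\<bottom>\<index>")
  greatest :: 'a ("\<top>\<index>")

locale bdl =
  fixes L :: "('a, 'x) blattice_scheme" (structure)
  assumes join_closed: "\<lbrakk>a \<in> carrier L; b \<in> carrier L\<rbrakk> \<Longrightarrow> a \<squnion> b \<in> carrier L"
    and meet_closed: "\<lbrakk>a \<in> carrier L; b \<in> carrier L\<rbrakk> \<Longrightarrow> a \<sqinter> b \<in> carrier L"
    and least_closed: "\<bottom> \<in> carrier L"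
    and greatest_closed: "\<top> \<in> carrier L"
    and join_commute: "\<lbrakk>a \<in> carrier L; b \<in> carrier L\<rbrakk> \<Longrightarrow> a \<squnion> b = b \<squnion> a"
    and meet_commute: "\<lbrakk>a \<in> carrier L; b \<in> carrier L\<rbrakk> \<Longrightarrow> a \<sqinter> b = b \<sqinter> a"
    and join_assoc: "\<lbrakk>a \<in> carrier L; b \<in> carrier L; c \<in> carrier L\<rbrakk>
      \<Longrightarrow> (a \<squnion> b) \<squnion> c = a \<squnion> (b \<squnion> c)"
    and meet_assoc: "\<lbrakk>a \<in> carrier L; b \<in> carrier L; c \<in> carrier L\<rbrakk>
      \<Longrightarrow> (a \<sqinter> b) \<sqinter> c = a \<sqinter> (b \<sqinter> c)"
    and join_absorb: "\<lbrakk>a \<in> carrier L; b \<in> carrier L\<rbrakk> \<Longrightarrow> a \<squnion> (a \<sqinter> b) = a"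
    and meet_absorb: "\<lbrakk>a \<in> carrier L; b \<in> carrier L\<rbrakk> \<Longrightarrow> a \<sqinter> (a \<squnion> b) = a"
    and distrib: "\<lbrakk>a \<in> carrier L; b \<in> carrier L; c \<in> carrier L\<rbrakk>
      \<Longrightarrow> a \<sqinter> (b \<squnion> c) = (a \<sqinter> b) \<squnion> (a \<sqinter> c)"
    and join_least: "a \<in> carrier L \<Longrightarrow> a \<squnion> \<bottom> = a"
    and meet_greatest: "a \<in> carrier L \<Longrightarrow> a \<sqinter> \<top> = a"

definition bdl_hom :: "('a, 'x) blattice_scheme \<Rightarrow> ('b, 'y) blattice_scheme \<Rightarrow> ('a \<Rightarrow> 'b) set" where
  "bdl_hom L M = {h. (\<forall>a\<in>carrier L. h a \<in> carrier M) \<and>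
     (\<forall>a\<in>carrier L. \<forall>b\<in>carrier L. h (a \<squnion>\<^bsub>L\<^esub> b) = h a \<squnion>\<^bsub>M\<^esub> h b) \<and>
     (\<forall>a\<in>carrier L. \<forall>b\<in>carrier L. h (a \<sqinter>\<^bsub>L\<^esub> b) = h a \<sqinter>\<^bsub>M\<^esub> h b) \<and>
     h \<bottom>\<^bsub>L\<^esub> = \<bottom>\<^bsub>M\<^esub> \<and> h \<top>\<^bsub>L\<^esub> = \<top>\<^bsub>M\<^esub>}"

definition bdl_iso :: "('a, 'x) blattice_scheme \<Rightarrow> ('b, 'y) blattice_scheme \<Rightarrow> bool" (infix "\<cong>" 50) where
  "L \<cong> M \<longleftrightarrow> bdl L \<and> bdl M \<and> (\<exists>h\<in>bdl_hom L M. bij_betw h (carrier L) (carrier M))"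

text \<open>The empty join is included, through the least element of \<open>L\<close>.\<close>

inductive_set join_closure :: "('a, 'x) blattice_scheme \<Rightarrow> 'a set \<Rightarrow> 'a set"
  for L :: "('a, 'x) blattice_scheme" and S :: "'a set" where
  empty: "\<bottom>\<^bsub>L\<^esub> \<in> join_closure L S"
| base: "a \<in> S \<Longrightarrow> a \<in> join_closure L S"
| join: "\<lbrakk>a \<in> join_closure L S; b \<in> join_closure L S\<rbrakk> \<Longrightarrow> a \<squnion>\<^bsub>L\<^esub> b \<in> join_closure L S"


section \<open>Coproducts of bounded distributive lattices\<close>

text \<open>The coproduct of \<open>L\<close> and \<open>M\<close> is presented by generators and relations: terms over the disjoint
  union of the carriers, modulo the axioms of bounded distributive lattices and the operation tables
  of \<open>L\<close> and \<open>M\<close>. Its universal property, with respect to bounded distributive lattices on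
  arbitrary types, is proved in \<open>coproduct_universal\<close> below.\<close>

datatype ('a, 'b) cterm =
    In1 'a | In2 'b | Bot | Top
  | Join "('a, 'b) cterm" "('a, 'b) cterm"
  | Meet "('a, 'b) cterm" "('a, 'b) cterm"

inductive_set cterms :: "('a, 'x) blattice_scheme \<Rightarrow> ('b, 'y) blattice_scheme \<Rightarrow> ('a, 'b) cterm set"
  for L :: "('a, 'x) blattice_scheme" and M :: "('b, 'y) blattice_scheme" where
  "a \<in> carrier L \<Longrightarrow> In1 a \<in> cterms L M"
| "b \<in> carrier M \<Longrightarrow> In2 b \<in> cterms L M"
| "Bot \<in> cterms L M"
| "Top \<in> cterms L M"
| "\<lbrakk>s \<in> cterms L M; t \<in> cterms L M\<rbrakk> \<Longrightarrow> Join s t \<in> cterms L M"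
| "\<lbrakk>s \<in> cterms L M; t \<in> cterms L M\<rbrakk> \<Longrightarrow> Meet s t \<in> cterms L M"

inductive_set crel :: "('a, 'x) blattice_scheme \<Rightarrow> ('b, 'y) blattice_scheme \<Rightarrow> ('a, 'b) cterm rel"
  for L :: "('a, 'x) blattice_scheme" and M :: "('b, 'y) blattice_scheme" where
  refl: "s \<in> cterms L M \<Longrightarrow> (s, s) \<in> crel L M"
| sym: "(s, t) \<in> crel L M \<Longrightarrow> (t, s) \<in> crel L M"
| trans: "\<lbrakk>(s, t) \<in> crel L M; (t, u) \<in> crel L M\<rbrakk> \<Longrightarrow> (s, u) \<in> crel L M"
| Join_cong: "\<lbrakk>(s, s') \<in> crel L M; (t, t') \<in> crel L M\<rbrakk> \<Longrightarrow> (Join s t, Join s' t') \<in> crel L M"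
| Meet_cong: "\<lbrakk>(s, s') \<in> crel L M; (t, t') \<in> crel L M\<rbrakk> \<Longrightarrow> (Meet s t, Meet s' t') \<in> crel L M"
| Join_commute: "\<lbrakk>s \<in> cterms L M; t \<in> cterms L M\<rbrakk> \<Longrightarrow> (Join s t, Join t s) \<in> crel L M"
| Meet_commute: "\<lbrakk>s \<in> cterms L M; t \<in> cterms L M\<rbrakk> \<Longrightarrow> (Meet s t, Meet t s) \<in> crel L M"
| Join_assoc: "\<lbrakk>s \<in> cterms L M; t \<in> cterms L M; u \<in> cterms L M\<rbrakk>
    \<Longrightarrow> (Join (Join s t) u, Join s (Join t u)) \<in> crel L M"
| Meet_assoc: "\<lbrakk>s \<in> cterms L M; t \<in> cterms L M; u \<in> cterms L M\<rbrakk>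
    \<Longrightarrow> (Meet (Meet s t) u, Meet s (Meet t u)) \<in> crel L M"
| Join_absorb: "\<lbrakk>s \<in> cterms L M; t \<in> cterms L M\<rbrakk> \<Longrightarrow> (Join s (Meet s t), s) \<in> crel L M"
| Meet_absorb: "\<lbrakk>s \<in> cterms L M; t \<in> cterms L M\<rbrakk> \<Longrightarrow> (Meet s (Join s t), s) \<in> crel L M"
| Distrib: "\<lbrakk>s \<in> cterms L M; t \<in> cterms L M; u \<in> cterms L M\<rbrakk>
    \<Longrightarrow> (Meet s (Join t u), Join (Meet s t) (Meet s u)) \<in> crel L M"
| Join_Bot: "s \<in> cterms L M \<Longrightarrow> (Join s Bot, s) \<in> crel L M"
| Meet_Top: "s \<in> cterms L M \<Longrightarrow> (Meet s Top, s) \<in> crel L M"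
| In1_join: "\<lbrakk>a \<in> carrier L; b \<in> carrier L\<rbrakk> \<Longrightarrow> (In1 (a \<squnion>\<^bsub>L\<^esub> b), Join (In1 a) (In1 b)) \<in> crel L M"
| In1_meet: "\<lbrakk>a \<in> carrier L; b \<in> carrier L\<rbrakk> \<Longrightarrow> (In1 (a \<sqinter>\<^bsub>L\<^esub> b), Meet (In1 a) (In1 b)) \<in> crel L M"
| In1_least: "(In1 \<bottom>\<^bsub>L\<^esub>, Bot) \<in> crel L M"
| In1_greatest: "(In1 \<top>\<^bsub>L\<^esub>, Top) \<in> crel L M"
| In2_join: "\<lbrakk>a \<in> carrier M; b \<in> carrier M\<rbrakk> \<Longrightarrow> (In2 (a \<squnion>\<^bsub>M\<^esub> b), Join (In2 a) (In2 b)) \<in> crel L M"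
| In2_meet: "\<lbrakk>a \<in> carrier M; b \<in> carrier M\<rbrakk> \<Longrightarrow> (In2 (a \<sqinter>\<^bsub>M\<^esub> b), Meet (In2 a) (In2 b)) \<in> crel L M"
| In2_least: "(In2 \<bottom>\<^bsub>M\<^esub>, Bot) \<in> crel L M"
| In2_greatest: "(In2 \<top>\<^bsub>M\<^esub>, Top) \<in> crel L M"

definition bdl_coproduct ::
  "('a, 'x) blattice_scheme \<Rightarrow> ('b, 'y) blattice_scheme \<Rightarrow> ('a, 'b) cterm set blattice"
  (infixr "\<amalg>" 65) where
  "L \<amalg> M =
     \<lparr>carrier = cterms L M // crel L M,
      join = (\<lambda>P Q. \<Union>s\<in>P. \<Union>t\<in>Q. crel L M `` {Join s t}),
      meet = (\<lambda>P Q. \<Union>s\<in>P. \<Union>t\<in>Q. crel L M `` {Meet s t}),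
      least = crel L M `` {Bot},
      greatest = crel L M `` {Top}\<rparr>"

definition coprod_in1 ::
  "('a, 'x) blattice_scheme \<Rightarrow> ('b, 'y) blattice_scheme \<Rightarrow> 'a \<Rightarrow> ('a, 'b) cterm set" where
  "coprod_in1 L M a = crel L M `` {In1 a}"

definition coprod_in2 ::
  "('a, 'x) blattice_scheme \<Rightarrow> ('b, 'y) blattice_scheme \<Rightarrow> 'b \<Rightarrow> ('a, 'b) cterm set" where
  "coprod_in2 L M b = crel L M `` {In2 b}"

primrec ceval :: "('c, 'z) blattice_scheme \<Rightarrow> ('a \<Rightarrow> 'c) \<Rightarrow> ('b \<Rightarrow> 'c) \<Rightarrow> ('a, 'b) cterm \<Rightarrow> 'c" where
  "ceval N f g (In1 a) = f a"
| "ceval N f g (In2 b) = g b"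
| "ceval N f g Bot = \<bottom>\<^bsub>N\<^esub>"
| "ceval N f g Top = \<top>\<^bsub>N\<^esub>"
| "ceval N f g (Join s t) = ceval N f g s \<squnion>\<^bsub>N\<^esub> ceval N f g t"
| "ceval N f g (Meet s t) = ceval N f g s \<sqinter>\<^bsub>N\<^esub> ceval N f g t"

context
  fixes L :: "('a, 'x) blattice_scheme" and M :: "('b, 'y) blattice_scheme"
  assumes L: "bdl L" and M: "bdl M"
begin

lemma crel_cterms: "(s, t) \<in> crel L M \<Longrightarrow> s \<in> cterms L M \<and> t \<in> cterms L M"
proof (induction rule: crel.induct)
qed (auto intro: cterms.intros bdl.join_closed[OF L] bdl.meet_closed[OF L] bdl.least_closed[OF L]
    bdl.greatest_closed[OF L] bdl.join_closed[OF M] bdl.meet_closed[OF M] bdl.least_closed[OF M]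
    bdl.greatest_closed[OF M])

lemma equiv_crel: "equiv (cterms L M) (crel L M)"
proof (rule equivI)
  show "crel L M \<subseteq> cterms L M \<times> cterms L M"
    using crel_cterms by auto
  show "refl_on (cterms L M) (crel L M)"
    by (auto simp: refl_on_def intro: crel.refl)
  show "sym (crel L M)" by (auto intro: symI crel.sym)
  show "trans (crel L M)" by (blast intro: transI crel.trans)
qed

lemma coproduct_join:
  assumes "s \<in> cterms L M" "t \<in> cterms L M"
  shows "(crel L M `` {s}) \<squnion>\<^bsub>L \<amalg> M\<^esub> (crel L M `` {t}) = crel L M `` {Join s t}"
proof -
  let ?P = "crel L M `` {s}" and ?Q = "crel L M `` {t}" and ?R = "crel L M `` {Join s t}"
  have eq: "crel L M `` {Join s' t'} = ?R" if "s' \<in> ?P" "t' \<in> ?Q" for s' t'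
    using that crel.Join_cong[of s s' L M t t'] equiv_class_eq[OF equiv_crel] by force
  have ne: "?P \<noteq> {}" "?Q \<noteq> {}"
    using crel.refl[OF assms(1)] crel.refl[OF assms(2)] by blast+
  have "(\<Union>s'\<in>?P. \<Union>t'\<in>?Q. crel L M `` {Join s' t'}) = (\<Union>s'\<in>?P. \<Union>t'\<in>?Q. ?R)"
    by (intro SUP_cong HOL.refl eq)
  also have "\<dots> = ?R"
    unfolding UN_constant using ne by simp
  finally show ?thesis
    by (simp only: bdl_coproduct_def blattice.simps)
qed

lemma coproduct_meet:
  assumes "s \<in> cterms L M" "t \<in> cterms L M"
  shows "(crel L M `` {s}) \<sqinter>\<^bsub>L \<amalg> M\<^esub> (crel L M `` {t}) = crel L M `` {Meet s t}"
proof -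
  let ?P = "crel L M `` {s}" and ?Q = "crel L M `` {t}" and ?R = "crel L M `` {Meet s t}"
  have eq: "crel L M `` {Meet s' t'} = ?R" if "s' \<in> ?P" "t' \<in> ?Q" for s' t'
    using that crel.Meet_cong[of s s' L M t t'] equiv_class_eq[OF equiv_crel] by force
  have ne: "?P \<noteq> {}" "?Q \<noteq> {}"
    using crel.refl[OF assms(1)] crel.refl[OF assms(2)] by blast+
  have "(\<Union>s'\<in>?P. \<Union>t'\<in>?Q. crel L M `` {Meet s' t'}) = (\<Union>s'\<in>?P. \<Union>t'\<in>?Q. ?R)"
    by (intro SUP_cong HOL.refl eq)
  also have "\<dots> = ?R"
    unfolding UN_constant using ne by simp
  finally show ?thesis
    by (simp only: bdl_coproduct_def blattice.simps)
qed

lemma coproduct_carrierE: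
  assumes "P \<in> carrier (L \<amalg> M)"
  obtains s where "s \<in> cterms L M" "P = crel L M `` {s}"
  using assms by (auto simp: bdl_coproduct_def elim: quotientE)

lemma coproduct_carrierI: "s \<in> cterms L M \<Longrightarrow> crel L M `` {s} \<in> carrier (L \<amalg> M)"
  by (auto simp: bdl_coproduct_def intro: quotientI)

lemma coproduct_least: "\<bottom>\<^bsub>L \<amalg> M\<^esub> = crel L M `` {Bot}"
  and coproduct_greatest: "\<top>\<^bsub>L \<amalg> M\<^esub> = crel L M `` {Top}"
  by (simp_all add: bdl_coproduct_def)

lemmas crel_class_eq = equiv_class_eq[OF equiv_crel]

lemmas crel_axioms = crel.Join_commute crel.Meet_commute crel.Join_assoc crel.Meet_assoc
  crel.Join_absorb crel.Meet_absorb crel.Distrib crel.Join_Bot crel.Meet_Top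
  crel.In1_join crel.In1_meet crel.In1_least crel.In1_greatest
  crel.In2_join crel.In2_meet crel.In2_least crel.In2_greatest

theorem bdl_coproduct: "bdl (L \<amalg> M)"
proof
qed (auto elim!: coproduct_carrierE intro!: coproduct_carrierI crel_class_eq crel_axioms del: equalityI
    simp: coproduct_join coproduct_meet coproduct_least coproduct_greatest cterms.intros)

theorem coprod_in1_hom: "coprod_in1 L M \<in> bdl_hom L (L \<amalg> M)"
  by (auto simp: bdl_hom_def coprod_in1_def coproduct_join coproduct_meet coproduct_least
      coproduct_greatest cterms.intros intro!: crel_class_eq coproduct_carrierI crel_axioms
      del: equalityI)

theorem coprod_in2_hom: "coprod_in2 L M \<in> bdl_hom M (L \<amalg> M)"
  by (auto simp: bdl_hom_def coprod_in2_def coproduct_join coproduct_meet coproduct_least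
      coproduct_greatest cterms.intros intro!: crel_class_eq coproduct_carrierI crel_axioms
      del: equalityI)

theorem coproduct_universal:
  fixes N :: "('c, 'z) blattice_scheme"
  assumes N: "bdl N" and f: "f \<in> bdl_hom L N" and g: "g \<in> bdl_hom M N"
  obtains h where "h \<in> bdl_hom (L \<amalg> M) N"
    "\<And>a. a \<in> carrier L \<Longrightarrow> h (coprod_in1 L M a) = f a"
    "\<And>b. b \<in> carrier M \<Longrightarrow> h (coprod_in2 L M b) = g b"
    "\<And>k P. \<lbrakk>k \<in> bdl_hom (L \<amalg> M) N;
        \<And>a. a \<in> carrier L \<Longrightarrow> k (coprod_in1 L M a) = f a;
        \<And>b. b \<in> carrier M \<Longrightarrow> k (coprod_in2 L M b) = g b;
        P \<in> carrier (L \<amalg> M)\<rbrakk> \<Longrightarrow> k P = h P"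
proof -
  let ?e = "ceval N f g"
  interpret N: bdl N by (rule N)
  have closed: "?e s \<in> carrier N" if "s \<in> cterms L M" for s
    using that f g
    by induction (auto simp: bdl_hom_def N.join_closed N.meet_closed N.least_closed N.greatest_closed)
  have resp: "?e s = ?e t" if "(s, t) \<in> crel L M" for s t
    using that
  proof induction
    case (Join_commute s t) then show ?case by (simp add: closed N.join_commute)
  next
    case (Meet_commute s t) then show ?case by (simp add: closed N.meet_commute)
  next
    case (Join_assoc s t u) then show ?case by (simp add: closed N.join_assoc)
  next
    case (Meet_assoc s t u) then show ?case by (simp add: closed N.meet_assoc)
  qed (use f g in \<open>auto simp: bdl_hom_def closed N.join_absorb N.meet_absorb N.distrib
        N.join_least N.meet_greatest\<close>)
  define h where "h P = ?e (SOME s. s \<in> P)" for P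
  have h: "h (crel L M `` {s}) = ?e s" if "s \<in> cterms L M" for s
  proof -
    have "s \<in> crel L M `` {s}" using that by (auto intro: crel.refl)
    then have "(SOME t. t \<in> crel L M `` {s}) \<in> crel L M `` {s}" by (rule someI)
    then show ?thesis unfolding h_def using resp by (metis Image_singleton_iff)
  qed
  show thesis
  proof
    show "h \<in> bdl_hom (L \<amalg> M) N"
      by (auto simp: bdl_hom_def coproduct_join coproduct_meet coproduct_least coproduct_greatest
          h closed cterms.intros elim!: coproduct_carrierE)
    show "h (coprod_in1 L M a) = f a" if "a \<in> carrier L" for a
      using that by (simp add: coprod_in1_def h cterms.intros)
    show "h (coprod_in2 L M b) = g b" if "b \<in> carrier M" for b
      using that by (simp add: coprod_in2_def h cterms.intros)
    show "k P = h P" if k: "k \<in> bdl_hom (L \<amalg> M) N"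
      and k1: "\<And>a. a \<in> carrier L \<Longrightarrow> k (coprod_in1 L M a) = f a"
      and k2: "\<And>b. b \<in> carrier M \<Longrightarrow> k (coprod_in2 L M b) = g b"
      and P: "P \<in> carrier (L \<amalg> M)" for k P
    proof -
      have "k (crel L M `` {s}) = ?e s" if "s \<in> cterms L M" for s
        using that
      proof induction
        case (5 s t)
        then have "k (crel L M `` {Join s t}) = k (crel L M `` {s}) \<squnion>\<^bsub>N\<^esub> k (crel L M `` {t})"
          using k by (simp add: bdl_hom_def coproduct_carrierI flip: coproduct_join)
        then show ?case using 5 by simp
      next
        case (6 s t)
        then have "k (crel L M `` {Meet s t}) = k (crel L M `` {s}) \<sqinter>\<^bsub>N\<^esub> k (crel L M `` {t})"
          using k by (simp add: bdl_hom_def coproduct_carrierI flip: coproduct_meet)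
        then show ?case using 6 by simp
      qed (use k k1 k2 in \<open>auto simp: bdl_hom_def coproduct_least coproduct_greatest
            coprod_in1_def coprod_in2_def\<close>)
      with P show ?thesis by (auto elim!: coproduct_carrierE simp: h)
    qed
  qed
qed

end


section \<open>Dynamical systems and attractors\<close>

text \<open>Time is a subset \<open>T\<close> of the reals, either \<open>\<int>\<close> or all of \<open>\<real>\<close>. The values of
  a system at times outside \<open>T\<^sup>+\<close> are irrelevant. The phase space is the
  whole type \<open>'a\<close>, hence nonempty; its compactness is assumed separately.\<close>

definition nonneg :: "real set \<Rightarrow> real set" where
  "nonneg T = {t \<in> T. 0 \<le> t}"

definition dynamical_system :: "real set \<Rightarrow> (real \<Rightarrow> 'a::metric_space \<Rightarrow> 'a) \<Rightarrow> bool" where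
  "dynamical_system T \<phi> \<longleftrightarrow>
     continuous_on (nonneg T \<times> UNIV) (\<lambda>(t, x). \<phi> t x) \<and>
     (\<forall>x. \<phi> 0 x = x) \<and>
     (\<forall>t\<in>nonneg T. \<forall>s\<in>nonneg T. \<forall>x. \<phi> t (\<phi> s x) = \<phi> (t + s) x)"

definition product_system ::
  "(real \<Rightarrow> 'a \<Rightarrow> 'a) \<Rightarrow> (real \<Rightarrow> 'b \<Rightarrow> 'b) \<Rightarrow> real \<Rightarrow> 'a \<times> 'b \<Rightarrow> 'a \<times> 'b" where
  "product_system \<phi>\<^sub>1 \<phi>\<^sub>2 = (\<lambda>t (x\<^sub>1, x\<^sub>2). (\<phi>\<^sub>1 t x\<^sub>1, \<phi>\<^sub>2 t x\<^sub>2))"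

definition invariant :: "real set \<Rightarrow> (real \<Rightarrow> 'a \<Rightarrow> 'a) \<Rightarrow> 'a set \<Rightarrow> bool" where
  "invariant T \<phi> S \<longleftrightarrow> (\<forall>t\<in>nonneg T. \<phi> t ` S = S)"

definition Inv :: "real set \<Rightarrow> (real \<Rightarrow> 'a \<Rightarrow> 'a) \<Rightarrow> 'a set \<Rightarrow> 'a set" where
  "Inv T \<phi> U = \<Union>{S. S \<subseteq> U \<and> invariant T \<phi> S}"

definition omega_limit :: "real set \<Rightarrow> (real \<Rightarrow> 'a::metric_space \<Rightarrow> 'a) \<Rightarrow> 'a set \<Rightarrow> 'a set" where
  "omega_limit T \<phi> U = (\<Inter>t\<in>nonneg T. closure (\<Union>s\<in>{s \<in> T. t \<le> s}. \<phi> s ` U))"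

definition attracting_nbhd :: "real set \<Rightarrow> (real \<Rightarrow> 'a::metric_space \<Rightarrow> 'a) \<Rightarrow> 'a set \<Rightarrow> bool" where
  "attracting_nbhd T \<phi> U \<longleftrightarrow>
     (\<exists>\<tau>\<in>T. \<tau> > 0 \<and> (\<forall>t\<in>T. \<tau> \<le> t \<longrightarrow> \<phi> t ` closure U \<subseteq> interior U))"

definition attractors :: "real set \<Rightarrow> (real \<Rightarrow> 'a::metric_space \<Rightarrow> 'a) \<Rightarrow> 'a set set" where
  "attractors T \<phi> = {omega_limit T \<phi> U | U. attracting_nbhd T \<phi> U}"

definition Att :: "real set \<Rightarrow> (real \<Rightarrow> 'a::metric_space \<Rightarrow> 'a) \<Rightarrow> 'a set blattice" where
  "Att T \<phi> =
     \<lparr>carrier = attractors T \<phi>,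
      join = (\<lambda>A B. A \<union> B),
      meet = (\<lambda>A B. omega_limit T \<phi> (A \<inter> B)),
      least = {},
      greatest = Inv T \<phi> UNIV\<rparr>"

text \<open>The sets \<open>L\<^sub>1\<close>, \<open>L\<^sub>2\<close> and \<open>L\<^sub>\<and>\<^sup>\<or>\<close> of attractors of the product system carry the lattice
  operations of \<open>Att T (product_system \<phi>\<^sub>1 \<phi>\<^sub>2)\<close>.\<close>

definition L1 :: "real set \<Rightarrow> (real \<Rightarrow> 'a::metric_space \<Rightarrow> 'a) \<Rightarrow> (real \<Rightarrow> 'b::metric_space \<Rightarrow> 'b)
    \<Rightarrow> ('a \<times> 'b) set blattice" where
  "L1 T \<phi>\<^sub>1 \<phi>\<^sub>2 = (Att T (product_system \<phi>\<^sub>1 \<phi>\<^sub>2))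
     \<lparr>carrier := {A\<^sub>1 \<times> Inv T \<phi>\<^sub>2 UNIV | A\<^sub>1. A\<^sub>1 \<in> attractors T \<phi>\<^sub>1}\<rparr>"

definition L2 :: "real set \<Rightarrow> (real \<Rightarrow> 'a::metric_space \<Rightarrow> 'a) \<Rightarrow> (real \<Rightarrow> 'b::metric_space \<Rightarrow> 'b)
    \<Rightarrow> ('a \<times> 'b) set blattice" where
  "L2 T \<phi>\<^sub>1 \<phi>\<^sub>2 = (Att T (product_system \<phi>\<^sub>1 \<phi>\<^sub>2))
     \<lparr>carrier := {Inv T \<phi>\<^sub>1 UNIV \<times> A\<^sub>2 | A\<^sub>2. A\<^sub>2 \<in> attractors T \<phi>\<^sub>2}\<rparr>"

definition L_meet :: "real set \<Rightarrow> (real \<Rightarrow> 'a::metric_space \<Rightarrow> 'a) \<Rightarrow> (real \<Rightarrow> 'b::metric_space \<Rightarrow> 'b)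
    \<Rightarrow> ('a \<times> 'b) set set" where
  "L_meet T \<phi>\<^sub>1 \<phi>\<^sub>2 = {A\<^sub>1 \<times> A\<^sub>2 | A\<^sub>1 A\<^sub>2. A\<^sub>1 \<in> attractors T \<phi>\<^sub>1 \<and> A\<^sub>2 \<in> attractors T \<phi>\<^sub>2}"

definition L_meet_join :: "real set \<Rightarrow> (real \<Rightarrow> 'a::metric_space \<Rightarrow> 'a)
    \<Rightarrow> (real \<Rightarrow> 'b::metric_space \<Rightarrow> 'b) \<Rightarrow> ('a \<times> 'b) set blattice" where
  "L_meet_join T \<phi>\<^sub>1 \<phi>\<^sub>2 = (Att T (product_system \<phi>\<^sub>1 \<phi>\<^sub>2))
     \<lparr>carrier := join_closure (Att T (product_system \<phi>\<^sub>1 \<phi>\<^sub>2)) (L_meet T \<phi>\<^sub>1 \<phi>\<^sub>2)\<rparr>"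

end

theory Submission
  imports Defs
begin

text \<open>
  Write \<open>I\<^sub>i\<close> for the maximal attractor of \<open>\<phi>\<^sub>i\<close>. The attractors of the two factors embed into
  those of the product system as the vertical strips \<open>A \<times> I\<^sub>2\<close> and the horizontal strips
  \<open>I\<^sub>1 \<times> B\<close>. A vertical and a horizontal strip meet in the rectangle \<open>A \<times> B\<close>, so the rectangles
  and their finite unions are exactly what the strips generate. What has to be seen is that the
  strips satisfy no relations beyond those valid in every bounded distributive lattice.

  By distributivity, every element of a coproduct is both a finite join of meets \<open>a \<sqinter> b\<close> and a
  finite meet of joins \<open>a' \<squnion> b'\<close>, with one component from each summand. Hence a
  homomorphism out of the coproduct is injective as soon as it reflects the inequalities
  \<open>a \<sqinter> b \<le> a' \<squnion> b'\<close>. This gives the criterion \<open>coproduct_iso_if_independent\<close>: a lattice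
  generated by images of \<open>L\<close> and \<open>M\<close> is their coproduct if such an inequality holds there only
  when \<open>a \<le> a'\<close> in \<open>L\<close> or \<open>b \<le> b'\<close> in \<open>M\<close>. For strips the inequality says
  \<open>A \<times> B \<subseteq> (C \<times> I\<^sub>2) \<union> (I\<^sub>1 \<times> D)\<close>; a pair consisting of a point of \<open>A\<close> outside \<open>C\<close> and a
  point of \<open>B\<close> outside \<open>D\<close> would violate it, so \<open>A \<subseteq> C\<close> or \<open>B \<subseteq> D\<close>. The criterion
  applies both to the lattices of strips and to the attractor lattices of the factors, and the
  two coproducts are isomorphic because both are isomorphic to the lattice of unions of rectangles.

  The dynamical input is that the attractors do form a bounded distributive lattice and that the
  meet of two rectangles is computed factorwise. Both become set-theoretic once \<open>\<omega>\<close>-limits are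
  traded for maximal invariant sets: by compactness \<open>\<omega>(U)\<close> is invariant, so
  \<open>\<omega>(U) = Inv(U)\<close> whenever \<open>\<omega>(U) \<subseteq> U\<close>, and \<open>Inv\<close> commutes with products because
  projections and products of invariant sets are invariant.
\<close>

section \<open>Order and duality in bounded distributive lattices\<close>

definition below :: "('a, 'x) blattice_scheme \<Rightarrow> 'a \<Rightarrow> 'a \<Rightarrow> bool" where
  "below L a b \<longleftrightarrow> a \<squnion>\<^bsub>L\<^esub> b = b"

text \<open>Passing to the opposite lattice turns statements about joins of meets into statements about
  meets of joins.\<close>

definition dual :: "('a, 'x) blattice_scheme \<Rightarrow> 'a blattice" where
  "dual L = \<lparr>carrier = carrier L, join = meet L, meet = join L,
     least = greatest L, greatest = least L\<rparr>"

lemma dual_simps [simp]: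
  "carrier (dual L) = carrier L" "join (dual L) = meet L" "meet (dual L) = join L"
  "least (dual L) = greatest L" "greatest (dual L) = least L"
  by (simp_all add: dual_def)

context bdl
begin

text \<open>The locale has only one of the two distributive laws; the other one is needed for the
  opposite lattice to be distributive.\<close>

lemma join_meet_distrib:
  assumes "a \<in> carrier L" "b \<in> carrier L" "c \<in> carrier L"
  shows "a \<squnion> (b \<sqinter> c) = (a \<squnion> b) \<sqinter> (a \<squnion> c)"
proof -
  note [simp] = join_closed meet_closed
  have "(a \<squnion> b) \<sqinter> (a \<squnion> c) = ((a \<squnion> b) \<sqinter> a) \<squnion> ((a \<squnion> b) \<sqinter> c)"
    using assms by (simp add: distrib)
  also have "(a \<squnion> b) \<sqinter> a = a"
    using assms meet_commute[of "a \<squnion> b" a] meet_absorb[of a b] by simp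
  also have "(a \<squnion> b) \<sqinter> c = (a \<sqinter> c) \<squnion> (b \<sqinter> c)"
    using assms meet_commute[of _ c] distrib[of c a b] by simp
  also have "a \<squnion> ((a \<sqinter> c) \<squnion> (b \<sqinter> c)) = a \<squnion> (b \<sqinter> c)"
    using assms join_absorb[of a c] join_assoc[of a "a \<sqinter> c" "b \<sqinter> c"] by simp
  finally show ?thesis ..
qed

lemma bdl_dual: "bdl (dual L)"
  by unfold_locales
    (simp_all add: join_closed meet_closed least_closed greatest_closed join_assoc meet_assoc
      join_absorb meet_absorb join_meet_distrib join_least meet_greatest,
      simp_all add: join_commute meet_commute)

lemma join_idem: "a \<in> carrier L \<Longrightarrow> a \<squnion> a = a"
  using join_absorb[of a "a \<squnion> a"] meet_absorb[of a a] join_closed by simp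

lemma below_iff_meet:
  assumes "a \<in> carrier L" "b \<in> carrier L"
  shows "below L a b \<longleftrightarrow> a \<sqinter> b = a"
  unfolding below_def
  using assms meet_absorb[of a b] join_absorb[of b a] meet_commute[of a b] join_commute[of a b]
  by (metis meet_closed join_commute)

lemma below_dual:
  assumes "a \<in> carrier L" "b \<in> carrier L"
  shows "below (dual L) a b \<longleftrightarrow> below L b a"
  using assms below_iff_meet[of b a] meet_commute[of a b] by (simp add: below_def)

lemma below_trans:
  assumes "a \<in> carrier L" "b \<in> carrier L" "c \<in> carrier L" "below L a b" "below L b c"
  shows "below L a c"
  using assms join_assoc[of a b c] by (simp add: below_def)

lemma below_antisym:
  assumes "a \<in> carrier L" "b \<in> carrier L" "below L a b" "below L b a"
  shows "a = b"
  using assms join_commute[of a b] by (simp add: below_def)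

lemma below_join1:
  assumes "a \<in> carrier L" "b \<in> carrier L"
  shows "below L a (a \<squnion> b)"
  using assms join_assoc[of a a b] by (simp add: below_def join_idem)

lemma below_join2:
  assumes "a \<in> carrier L" "b \<in> carrier L"
  shows "below L b (a \<squnion> b)"
  using assms below_join1[of b a] join_commute[of a b] by simp

lemma join_below_iff:
  assumes "a \<in> carrier L" "b \<in> carrier L" "c \<in> carrier L"
  shows "below L (a \<squnion> b) c \<longleftrightarrow> below L a c \<and> below L b c"
proof
  assume "below L (a \<squnion> b) c"
  then show "below L a c \<and> below L b c"
    using assms below_trans[of _ "a \<squnion> b" c] below_join1[of a b] below_join2[of a b] join_closed
    by blast
next
  assume "below L a c \<and> below L b c"
  then show "below L (a \<squnion> b) c"
    using assms join_assoc[of a b c] by (simp add: below_def)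
qed

lemma least_below: "a \<in> carrier L \<Longrightarrow> below L \<bottom> a"
  using join_commute[of "\<bottom>" a] by (simp add: below_def join_least least_closed)

lemma meet_medial:
  assumes "a \<in> carrier L" "b \<in> carrier L" "c \<in> carrier L" "d \<in> carrier L"
  shows "(a \<sqinter> b) \<sqinter> (c \<sqinter> d) = (a \<sqinter> c) \<sqinter> (b \<sqinter> d)"
proof -
  have "b \<sqinter> (c \<sqinter> d) = c \<sqinter> (b \<sqinter> d)"
    using assms meet_assoc[of b c d] meet_assoc[of c b d] meet_commute[of b c] by simp
  then show ?thesis
    using assms by (simp add: meet_assoc meet_closed)
qed

lemma join_closure_carrier:
  assumes "S \<subseteq> carrier L" "x \<in> join_closure L S"
  shows "x \<in> carrier L"
  using assms(2) by induction (use assms(1) in \<open>auto intro: least_closed join_closed\<close>)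

text \<open>Distributivity lets a meet of two finite joins be expanded into a join of meets of
  generators.\<close>

lemma join_closure_meet:
  assumes S: "S \<subseteq> carrier L" and meet: "\<And>s t. s \<in> S \<Longrightarrow> t \<in> S \<Longrightarrow> s \<sqinter> t \<in> S"
    and x: "x \<in> join_closure L S" and y: "y \<in> join_closure L S"
  shows "x \<sqinter> y \<in> join_closure L S"
proof -
  note carrier = join_closure_carrier[OF S] subsetD[OF S]
  have least_meet: "\<bottom> \<sqinter> z = \<bottom>" if "z \<in> carrier L" for z
    using that least_below[of z] below_iff_meet[of "\<bottom>" z] least_closed by simp
  have one: "s \<sqinter> y \<in> join_closure L S" if "s \<in> S" for s
    using y
  proof induction
    case empty
    then show ?case
      using that carrier least_meet[of s] meet_commute[of s "\<bottom>"] least_closed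
      by (simp add: join_closure.empty)
  next
    case (base t)
    then show ?case using that meet by (blast intro: join_closure.base)
  next
    case (join t u)
    then show ?case using that carrier by (simp add: distrib join_closure.join)
  qed
  show ?thesis
    using x
  proof induction
    case empty
    then show ?case using y carrier least_meet by (simp add: join_closure.empty)
  next
    case (base s)
    then show ?case by (rule one)
  next
    case (join t u)
    have "(t \<squnion> u) \<sqinter> y = (t \<sqinter> y) \<squnion> (u \<sqinter> y)"
      using join.hyps y carrier meet_commute[of _ y] distrib[of y t u] join_closed by simp
    then show ?case using join.IH by (simp add: join_closure.join)
  qed
qed

lemma bdl_sublattice:
  assumes "S \<subseteq> carrier L" "\<And>a b. a \<in> S \<Longrightarrow> b \<in> S \<Longrightarrow> a \<squnion> b \<in> S"
    "\<And>a b. a \<in> S \<Longrightarrow> b \<in> S \<Longrightarrow> a \<sqinter> b \<in> S" "\<bottom> \<in> S" "\<top> \<in> S"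
  shows "bdl (L\<lparr>carrier := S\<rparr>)"
  using assms
  by unfold_locales
    (auto simp: subset_iff join_assoc meet_assoc join_absorb meet_absorb distrib join_least
      meet_greatest intro: join_commute meet_commute)

end

lemma bdl_hom_carrier: "h \<in> bdl_hom L M \<Longrightarrow> a \<in> carrier L \<Longrightarrow> h a \<in> carrier M"
  and bdl_hom_join: "h \<in> bdl_hom L M \<Longrightarrow> a \<in> carrier L \<Longrightarrow> b \<in> carrier L
    \<Longrightarrow> h (a \<squnion>\<^bsub>L\<^esub> b) = h a \<squnion>\<^bsub>M\<^esub> h b"
  and bdl_hom_meet: "h \<in> bdl_hom L M \<Longrightarrow> a \<in> carrier L \<Longrightarrow> b \<in> carrier L
    \<Longrightarrow> h (a \<sqinter>\<^bsub>L\<^esub> b) = h a \<sqinter>\<^bsub>M\<^esub> h b"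
  and bdl_hom_least: "h \<in> bdl_hom L M \<Longrightarrow> h \<bottom>\<^bsub>L\<^esub> = \<bottom>\<^bsub>M\<^esub>"
  and bdl_hom_greatest: "h \<in> bdl_hom L M \<Longrightarrow> h \<top>\<^bsub>L\<^esub> = \<top>\<^bsub>M\<^esub>"
  by (auto simp: bdl_hom_def)

lemmas bdl_hom_simps = bdl_hom_join bdl_hom_meet bdl_hom_least bdl_hom_greatest

lemma bdl_hom_below:
  assumes "h \<in> bdl_hom L M" "a \<in> carrier L" "b \<in> carrier L" "below L a b"
  shows "below M (h a) (h b)"
  using assms bdl_hom_join[of h L M a b] by (simp add: below_def)

lemma bdl_hom_restrict:
  assumes "h \<in> bdl_hom L M" "h ` carrier L \<subseteq> K"
  shows "h \<in> bdl_hom L (M\<lparr>carrier := K\<rparr>)"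
  using assms by (auto simp: bdl_hom_def)

lemma bdl_hom_image:
  assumes L: "bdl L" and M: "bdl M" and h: "h \<in> bdl_hom L M"
  shows "bdl (M\<lparr>carrier := h ` carrier L\<rparr>)"
proof (rule bdl.bdl_sublattice[OF M])
  interpret L: bdl L by (rule L)
  show "h ` carrier L \<subseteq> carrier M"
    using bdl_hom_carrier[OF h] by blast
  show "x \<squnion>\<^bsub>M\<^esub> y \<in> h ` carrier L" "x \<sqinter>\<^bsub>M\<^esub> y \<in> h ` carrier L"
    if "x \<in> h ` carrier L" "y \<in> h ` carrier L" for x y
    using that L.join_closed L.meet_closed
    by (auto simp flip: bdl_hom_join[OF h] bdl_hom_meet[OF h])
  show "\<bottom>\<^bsub>M\<^esub> \<in> h ` carrier L" "\<top>\<^bsub>M\<^esub> \<in> h ` carrier L"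
    using L.least_closed L.greatest_closed bdl_hom_least[OF h] bdl_hom_greatest[OF h]
    by (metis image_eqI)+
qed

lemma bdl_hom_dual: "h \<in> bdl_hom L M \<Longrightarrow> h \<in> bdl_hom (dual L) (dual M)"
  by (auto simp: bdl_hom_def)

lemma join_closure_update_carrier: "join_closure (L\<lparr>carrier := K\<rparr>) S = join_closure L S"
proof (intro set_eqI iffI)
  show "x \<in> join_closure L S" if "x \<in> join_closure (L\<lparr>carrier := K\<rparr>) S" for x
    using that by induction (simp_all add: join_closure.intros)
  show "x \<in> join_closure (L\<lparr>carrier := K\<rparr>) S" if "x \<in> join_closure L S" for x
    using that
    by induction (use join_closure.intros[where L = "L\<lparr>carrier := K\<rparr>"] in simp_all)
qed

lemma bdl_iso_sym:
  assumes "L \<cong> M"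
  shows "M \<cong> L"
proof -
  obtain h where L: "bdl L" and M: "bdl M" and h: "h \<in> bdl_hom L M"
    and bij: "bij_betw h (carrier L) (carrier M)"
    using assms by (auto simp: bdl_iso_def)
  interpret L: bdl L by (rule L)
  let ?k = "inv_into (carrier L) h"
  have k: "?k b \<in> carrier L" "h (?k b) = b" if "b \<in> carrier M" for b
    using that bij by (auto simp: bij_betw_def intro: inv_into_into f_inv_into_f)
  have eq: "?k b = a" if "a \<in> carrier L" "h a = b" for a b
    using that bij by (auto simp: bij_betw_def)
  have "?k \<in> bdl_hom M L"
    unfolding bdl_hom_def
    by (auto simp: k bdl_hom_simps[OF h] L.join_closed L.meet_closed L.least_closed
        L.greatest_closed intro!: eq)
  then show ?thesis
    using L M bij_betw_inv_into[OF bij] by (auto simp: bdl_iso_def)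
qed

lemma bdl_iso_trans:
  assumes "L \<cong> M" "M \<cong> N"
  shows "L \<cong> N"
proof -
  obtain h k where h: "h \<in> bdl_hom L M" "bij_betw h (carrier L) (carrier M)"
    and k: "k \<in> bdl_hom M N" "bij_betw k (carrier M) (carrier N)"
    using assms by (auto simp: bdl_iso_def)
  have "k \<circ> h \<in> bdl_hom L N"
    using h(1) k(1) by (simp add: bdl_hom_def)
  then show ?thesis
    using assms bij_betw_trans[OF h(2) k(2)] by (auto simp: bdl_iso_def)
qed

section \<open>Recognising a coproduct\<close>

text \<open>An upper bound of a finite join is a common upper bound of the joinands, so for a fixed
  right-hand side the order need only be reflected on join generators.\<close>

lemma reflects_below_join_closure:
  assumes "bdl C" "bdl N" "h \<in> bdl_hom C N" "S \<subseteq> carrier C" "y \<in> carrier C"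
    and S: "\<And>s. s \<in> S \<Longrightarrow> below N (h s) (h y) \<Longrightarrow> below C s y"
    and x: "x \<in> join_closure C S" and "below N (h x) (h y)"
  shows "below C x y"
  using x \<open>below N (h x) (h y)\<close>
proof induction
  case empty
  then show ?case using assms by (simp add: bdl.least_below)
next
  case (base a)
  then show ?case using S by blast
next
  case (join a b)
  have "a \<in> carrier C" "b \<in> carrier C"
    using join.hyps assms bdl.join_closure_carrier by metis+
  then show ?case
    using join assms bdl_hom_carrier[OF \<open>h \<in> bdl_hom C N\<close>]
    by (simp add: bdl.join_below_iff bdl_hom_join[OF \<open>h \<in> bdl_hom C N\<close>])
qed

text \<open>Join generators on the left and meet generators on the right: \<open>\<Squnion>\<^sub>i s\<^sub>i \<le> \<Sqinter>\<^sub>j s'\<^sub>j\<close>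
  holds exactly if every \<open>s\<^sub>i \<le> s'\<^sub>j\<close> does. The right-hand side is reduced by applying the
  preceding lemma to the opposite lattices.\<close>

lemma inj_on_if_reflects_generators:
  assumes C: "bdl C" and N: "bdl N" and h: "h \<in> bdl_hom C N"
    and S: "S \<subseteq> carrier C" and genS: "carrier C \<subseteq> join_closure C S"
    and S': "S' \<subseteq> carrier C" and genS': "carrier C \<subseteq> join_closure (dual C) S'"
    and reflect: "\<And>s s'. s \<in> S \<Longrightarrow> s' \<in> S' \<Longrightarrow> below N (h s) (h s') \<Longrightarrow> below C s s'"
  shows "inj_on h (carrier C)"
proof -
  note below_dual = bdl.below_dual[OF C] bdl.below_dual[OF N] bdl_hom_carrier[OF h]
  have S_below: "below C s y" if "s \<in> S" "y \<in> carrier C" "below N (h s) (h y)" for s y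
    using reflects_below_join_closure[OF bdl.bdl_dual[OF C] bdl.bdl_dual[OF N] bdl_hom_dual[OF h],
        of S' s y] that S S' genS' reflect
    by (simp add: below_dual subset_iff)
  have "below C x y" if "x \<in> carrier C" "y \<in> carrier C" "below N (h x) (h y)" for x y
    using reflects_below_join_closure[OF C N h S \<open>y \<in> carrier C\<close> S_below] that genS by blast
  then show ?thesis
    by (intro inj_onI) (metis C N h bdl.below_antisym bdl.join_idem bdl_hom_carrier below_def)
qed

text \<open>The normal form in a lattice generated by two homomorphic images: the elements
  \<open>p a \<sqinter> q b\<close> contain both images, since \<open>p a = p a \<sqinter> q \<top>\<close>, and they are closed under meets,
  so their finite joins form a sublattice. Stating this for any such lattice \<open>D\<close>, and not only
  for a coproduct, makes it available for the opposite of a coproduct as well.\<close>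

lemma join_of_meets_if_generated:
  assumes L: "bdl L" and M: "bdl M" and D: "bdl D"
    and p: "p \<in> bdl_hom L D" and q: "q \<in> bdl_hom M D"
    and generated: "\<And>K. \<lbrakk>p ` carrier L \<subseteq> K; q ` carrier M \<subseteq> K;
        \<And>x y. x \<in> K \<Longrightarrow> y \<in> K \<Longrightarrow> x \<squnion>\<^bsub>D\<^esub> y \<in> K;
        \<And>x y. x \<in> K \<Longrightarrow> y \<in> K \<Longrightarrow> x \<sqinter>\<^bsub>D\<^esub> y \<in> K\<rbrakk> \<Longrightarrow> carrier D \<subseteq> K"
  shows "carrier D \<subseteq> join_closure D
    {p a \<sqinter>\<^bsub>D\<^esub> q b | a b. a \<in> carrier L \<and> b \<in> carrier M}"
  (is "_ \<subseteq> join_closure _ ?S")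
proof (rule generated)
  interpret L: bdl L by (rule L)
  interpret M: bdl M by (rule M)
  interpret D: bdl D by (rule D)
  note in_D = bdl_hom_carrier[OF p] bdl_hom_carrier[OF q]
  have S: "?S \<subseteq> carrier D"
    by (auto intro: D.meet_closed in_D)
  show "p ` carrier L \<subseteq> join_closure D ?S"
  proof
    fix x assume "x \<in> p ` carrier L"
    then obtain a where a: "a \<in> carrier L" "x = p a" by blast
    then have "x = p a \<sqinter>\<^bsub>D\<^esub> q \<top>\<^bsub>M\<^esub>"
      by (simp add: bdl_hom_greatest[OF q] D.meet_greatest in_D)
    then show "x \<in> join_closure D ?S"
      using a M.greatest_closed by (blast intro: join_closure.base)
  qed
  show "q ` carrier M \<subseteq> join_closure D ?S"
  proof
    fix x assume "x \<in> q ` carrier M"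
    then obtain b where b: "b \<in> carrier M" "x = q b" by blast
    then have "x = p \<top>\<^bsub>L\<^esub> \<sqinter>\<^bsub>D\<^esub> q b"
      using D.meet_commute[OF D.greatest_closed, of "q b"]
      by (simp add: bdl_hom_greatest[OF p] D.meet_greatest in_D)
    then show "x \<in> join_closure D ?S"
      using b L.greatest_closed by (blast intro: join_closure.base)
  qed
  show "x \<squnion>\<^bsub>D\<^esub> y \<in> join_closure D ?S"
    if "x \<in> join_closure D ?S" "y \<in> join_closure D ?S" for x y
    using that by (rule join_closure.join)
  have "s \<sqinter>\<^bsub>D\<^esub> t \<in> ?S" if s: "s \<in> ?S" and t: "t \<in> ?S" for s t
  proof -
    obtain a b where ab: "a \<in> carrier L" "b \<in> carrier M" and s_eq: "s = p a \<sqinter>\<^bsub>D\<^esub> q b"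
      using s by blast
    obtain c d where cd: "c \<in> carrier L" "d \<in> carrier M" and t_eq: "t = p c \<sqinter>\<^bsub>D\<^esub> q d"
      using t by blast
    have "s \<sqinter>\<^bsub>D\<^esub> t = p (a \<sqinter>\<^bsub>L\<^esub> c) \<sqinter>\<^bsub>D\<^esub> q (b \<sqinter>\<^bsub>M\<^esub> d)"
      using ab cd unfolding s_eq t_eq
      by (simp add: bdl_hom_meet[OF p] bdl_hom_meet[OF q] in_D D.meet_medial)
    then show ?thesis
      using ab cd L.meet_closed M.meet_closed by blast
  qed
  then show "x \<sqinter>\<^bsub>D\<^esub> y \<in> join_closure D ?S"
    if "x \<in> join_closure D ?S" "y \<in> join_closure D ?S" for x y
    using that by (intro D.join_closure_meet[OF S])
qed

context
  fixes L :: "('a, 'x) blattice_scheme" and M :: "('b, 'y) blattice_scheme"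
  assumes L: "bdl L" and M: "bdl M"
begin

interpretation L: bdl L by (rule L)
interpretation M: bdl M by (rule M)
interpretation C: bdl "L \<amalg> M" by (rule bdl_coproduct[OF L M])

lemma coproduct_generated:
  assumes in1: "coprod_in1 L M ` carrier L \<subseteq> K"
    and in2: "coprod_in2 L M ` carrier M \<subseteq> K"
    and join: "\<And>x y. x \<in> K \<Longrightarrow> y \<in> K \<Longrightarrow> x \<squnion>\<^bsub>L \<amalg> M\<^esub> y \<in> K"
    and meet: "\<And>x y. x \<in> K \<Longrightarrow> y \<in> K \<Longrightarrow> x \<sqinter>\<^bsub>L \<amalg> M\<^esub> y \<in> K"
  shows "carrier (L \<amalg> M) \<subseteq> K"
proof
  fix P assume "P \<in> carrier (L \<amalg> M)"
  then obtain s where s: "s \<in> cterms L M" and P: "P = crel L M `` {s}"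
    by (rule coproduct_carrierE[OF L M])
  have "crel L M `` {s} \<in> K"
    using s
  proof induction
    case (1 a) then show ?case using in1 by (auto simp: coprod_in1_def)
  next
    case (2 b) then show ?case using in2 by (auto simp: coprod_in2_def)
  next
    case 3
    show ?case
      using subsetD[OF in1 imageI[OF L.least_closed]] bdl_hom_least[OF coprod_in1_hom[OF L M]]
      by (simp add: coproduct_least[OF L M])
  next
    case 4
    show ?case
      using subsetD[OF in1 imageI[OF L.greatest_closed]] bdl_hom_greatest[OF coprod_in1_hom[OF L M]]
      by (simp add: coproduct_greatest[OF L M])
  next
    case (5 s t) then show ?case using join by (metis coproduct_join[OF L M])
  next
    case (6 s t) then show ?case using meet by (metis coproduct_meet[OF L M])
  qed
  then show "P \<in> K" using P by simp
qed

lemmas in1_hom = coprod_in1_hom[OF L M] and in2_hom = coprod_in2_hom[OF L M]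

lemmas in_carrier = bdl_hom_carrier[OF in1_hom] bdl_hom_carrier[OF in2_hom]

lemma coproduct_join_of_meets:
  "carrier (L \<amalg> M) \<subseteq> join_closure (L \<amalg> M)
     {coprod_in1 L M a \<sqinter>\<^bsub>L \<amalg> M\<^esub> coprod_in2 L M b | a b. a \<in> carrier L \<and> b \<in> carrier M}"
  by (rule join_of_meets_if_generated[OF L M C.bdl_axioms in1_hom in2_hom coproduct_generated])

text \<open>This is the preceding normal form read in the opposite lattice.\<close>

lemma coproduct_meet_of_joins:
  "carrier (L \<amalg> M) \<subseteq> join_closure (dual (L \<amalg> M))
     {coprod_in1 L M a \<squnion>\<^bsub>L \<amalg> M\<^esub> coprod_in2 L M b | a b. a \<in> carrier L \<and> b \<in> carrier M}"
  by (rule join_of_meets_if_generated[OF L.bdl_dual M.bdl_dual C.bdl_dual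
        bdl_hom_dual[OF in1_hom] bdl_hom_dual[OF in2_hom], unfolded dual_simps],
      rule coproduct_generated)

text \<open>The universal property supplies the homomorphism out of the coproduct. It is onto because
  \<open>N\<close> is generated by the two images, and injective because the two normal forms reduce
  every inequality in the coproduct to one of the kind that independence controls.\<close>

theorem coproduct_iso_if_independent:
  assumes N: "bdl N" and f: "f \<in> bdl_hom L N" and g: "g \<in> bdl_hom M N"
    and generated: "carrier N \<subseteq> join_closure N
      {f a \<sqinter>\<^bsub>N\<^esub> g b | a b. a \<in> carrier L \<and> b \<in> carrier M}"
    and independent: "\<And>a b a' b'. \<lbrakk>a \<in> carrier L; a' \<in> carrier L; b \<in> carrier M; b' \<in> carrier M;
        below N (f a \<sqinter>\<^bsub>N\<^esub> g b) (f a' \<squnion>\<^bsub>N\<^esub> g b')\<rbrakk> \<Longrightarrow> below L a a' \<or> below M b b'"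
  shows "N \<cong> L \<amalg> M"
proof (rule coproduct_universal[OF L M N f g])
  interpret N: bdl N by (rule N)
  fix h
  assume h: "h \<in> bdl_hom (L \<amalg> M) N"
    and h1: "\<And>a. a \<in> carrier L \<Longrightarrow> h (coprod_in1 L M a) = f a"
    and h2: "\<And>b. b \<in> carrier M \<Longrightarrow> h (coprod_in2 L M b) = g b"
  let ?S = "{coprod_in1 L M a \<sqinter>\<^bsub>L \<amalg> M\<^esub> coprod_in2 L M b | a b. a \<in> carrier L \<and> b \<in> carrier M}"
  let ?S' = "{coprod_in1 L M a \<squnion>\<^bsub>L \<amalg> M\<^esub> coprod_in2 L M b | a b. a \<in> carrier L \<and> b \<in> carrier M}"
  have "inj_on h (carrier (L \<amalg> M))"
  proof (rule inj_on_if_reflects_generators[OF C.bdl_axioms N h _ coproduct_join_of_meets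
        _ coproduct_meet_of_joins])
    show "?S \<subseteq> carrier (L \<amalg> M)" "?S' \<subseteq> carrier (L \<amalg> M)"
      by (auto intro: C.meet_closed C.join_closed in_carrier)
    fix s s' assume "s \<in> ?S" "s' \<in> ?S'" and le: "below N (h s) (h s')"
    then obtain a b a' b' where ab: "a \<in> carrier L" "b \<in> carrier M" "a' \<in> carrier L" "b' \<in> carrier M"
      and s: "s = coprod_in1 L M a \<sqinter>\<^bsub>L \<amalg> M\<^esub> coprod_in2 L M b"
      and s': "s' = coprod_in1 L M a' \<squnion>\<^bsub>L \<amalg> M\<^esub> coprod_in2 L M b'"
      by blast
    let ?a = "coprod_in1 L M a" and ?a' = "coprod_in1 L M a'"
    let ?b = "coprod_in2 L M b" and ?b' = "coprod_in2 L M b'"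
    have in_C: "?a \<in> carrier (L \<amalg> M)" "?b \<in> carrier (L \<amalg> M)"
      "?a' \<in> carrier (L \<amalg> M)" "?b' \<in> carrier (L \<amalg> M)"
      using ab by (simp_all add: in_carrier)
    then have s_C: "s \<in> carrier (L \<amalg> M)" "s' \<in> carrier (L \<amalg> M)"
      by (simp_all add: s s' C.meet_closed C.join_closed)
    have s_below: "below (L \<amalg> M) s ?a" "below (L \<amalg> M) s ?b"
      using bdl.below_join1[OF C.bdl_dual, of ?a ?b] bdl.below_join2[OF C.bdl_dual, of ?a ?b] in_C
      by (simp_all add: s C.below_dual C.meet_closed)
    have below_s': "below (L \<amalg> M) ?a' s'" "below (L \<amalg> M) ?b' s'"
      using in_C by (simp_all add: s' C.below_join1 C.below_join2)
    have "below L a a' \<or> below M b b'"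
      using ab le in_C
      by (intro independent) (simp_all add: s s' bdl_hom_meet[OF h] bdl_hom_join[OF h] h1 h2)
    then show "below (L \<amalg> M) s s'"
    proof
      assume "below L a a'"
      then have "below (L \<amalg> M) ?a ?a'"
        using bdl_hom_below[OF in1_hom] ab by simp
      then have "below (L \<amalg> M) s ?a'"
        using s_below(1) s_C in_C C.below_trans[of s ?a ?a'] by simp
      then show ?thesis
        using below_s'(1) s_C in_C C.below_trans[of s ?a' s'] by simp
    next
      assume "below M b b'"
      then have "below (L \<amalg> M) ?b ?b'"
        using bdl_hom_below[OF in2_hom] ab by simp
      then have "below (L \<amalg> M) s ?b'"
        using s_below(2) s_C in_C C.below_trans[of s ?b ?b'] by simp
      then show ?thesis
        using below_s'(2) s_C in_C C.below_trans[of s ?b' s'] by simp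
    qed
  qed
  moreover have "y \<in> h ` carrier (L \<amalg> M)" if "y \<in> carrier N" for y
    using subsetD[OF generated that]
  proof induction
    case empty
    then show ?case
      using bdl_hom_least[OF h] C.least_closed by (metis image_eqI)
  next
    case (base y)
    then obtain a b where "a \<in> carrier L" "b \<in> carrier M" "y = f a \<sqinter>\<^bsub>N\<^esub> g b"
      by blast
    then have "y = h (coprod_in1 L M a \<sqinter>\<^bsub>L \<amalg> M\<^esub> coprod_in2 L M b)"
      "coprod_in1 L M a \<sqinter>\<^bsub>L \<amalg> M\<^esub> coprod_in2 L M b \<in> carrier (L \<amalg> M)"
      by (simp_all add: bdl_hom_meet[OF h] h1 h2 in_carrier C.meet_closed)
    then show ?case by blast
  next
    case (join y z)
    then obtain p q where "p \<in> carrier (L \<amalg> M)" "q \<in> carrier (L \<amalg> M)" "y = h p" "z = h q"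
      by blast
    then show ?case
      by (metis bdl_hom_join[OF h] C.join_closed image_eqI)
  qed
  ultimately have "bij_betw h (carrier (L \<amalg> M)) (carrier N)"
    using bdl_hom_carrier[OF h] by (auto simp: bij_betw_def)
  then have "L \<amalg> M \<cong> N"
    using h N C.bdl_axioms by (auto simp: bdl_iso_def)
  then show "N \<cong> L \<amalg> M" by (rule bdl_iso_sym)
qed

end

section \<open>Limit sets and invariant sets\<close>

definition orbit_tail :: "real set \<Rightarrow> (real \<Rightarrow> 'a \<Rightarrow> 'a) \<Rightarrow> 'a set \<Rightarrow> real \<Rightarrow> 'a set" where
  "orbit_tail T \<phi> U t = (\<Union>s\<in>{s \<in> T. t \<le> s}. \<phi> s ` U)"

lemma omega_limit_eq: "omega_limit T \<phi> U = (\<Inter>t\<in>nonneg T. closure (orbit_tail T \<phi> U t))"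
  by (simp add: omega_limit_def orbit_tail_def)

lemma orbit_tail_antimono: "s \<le> t \<Longrightarrow> orbit_tail T \<phi> U t \<subseteq> orbit_tail T \<phi> U s"
  by (force simp: orbit_tail_def)

lemma omega_limit_mono: "U \<subseteq> V \<Longrightarrow> omega_limit T \<phi> U \<subseteq> omega_limit T \<phi> V"
  unfolding omega_limit_def by (intro INF_mono' closure_mono UN_mono) auto

text \<open>A point outside both limit sets has left both closed orbit tails at the later of two
  times. This is what makes the lattice of attractors distributive.\<close>

lemma omega_limit_Un: "omega_limit T \<phi> (U \<union> V) = omega_limit T \<phi> U \<union> omega_limit T \<phi> V"
proof
  show "omega_limit T \<phi> U \<union> omega_limit T \<phi> V \<subseteq> omega_limit T \<phi> (U \<union> V)"
    by (simp add: omega_limit_mono)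
  have tail_Un: "orbit_tail T \<phi> (U \<union> V) t = orbit_tail T \<phi> U t \<union> orbit_tail T \<phi> V t" for t
    by (auto simp: orbit_tail_def)
  show "omega_limit T \<phi> (U \<union> V) \<subseteq> omega_limit T \<phi> U \<union> omega_limit T \<phi> V"
  proof (rule subsetI, rule ccontr)
    fix x assume x: "x \<in> omega_limit T \<phi> (U \<union> V)"
      and "x \<notin> omega_limit T \<phi> U \<union> omega_limit T \<phi> V"
    then obtain s t where st: "s \<in> nonneg T" "t \<in> nonneg T"
      and "x \<notin> closure (orbit_tail T \<phi> U s)" "x \<notin> closure (orbit_tail T \<phi> V t)"
      by (auto simp: omega_limit_eq)
    then have "x \<notin> closure (orbit_tail T \<phi> (U \<union> V) (max s t))"
      using closure_mono[OF orbit_tail_antimono[of s "max s t" T \<phi> U]]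
        closure_mono[OF orbit_tail_antimono[of t "max s t" T \<phi> V]]
      by (auto simp: tail_Un)
    moreover have "max s t \<in> nonneg T"
      using st by (simp add: max_def)
    ultimately show False using x by (auto simp: omega_limit_eq)
  qed
qed

lemma omega_limit_empty: "nonneg T \<noteq> {} \<Longrightarrow> omega_limit T \<phi> {} = {}"
  by (auto simp: omega_limit_def)

lemma closed_omega_limit: "closed (omega_limit T \<phi> U)"
  by (auto simp: omega_limit_def)

lemma invariant_subset_Inv: "invariant T \<phi> S \<Longrightarrow> S \<subseteq> U \<Longrightarrow> S \<subseteq> Inv T \<phi> U"
  by (auto simp: Inv_def)

lemma Inv_subset: "Inv T \<phi> U \<subseteq> U"
  by (auto simp: Inv_def)

lemma invariant_Inv: "invariant T \<phi> (Inv T \<phi> U)"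
  unfolding invariant_def
proof
  fix t assume "t \<in> nonneg T"
  then have "\<phi> t ` S = S" if "S \<in> {S. S \<subseteq> U \<and> invariant T \<phi> S}" for S
    using that by (auto simp: invariant_def)
  then show "\<phi> t ` Inv T \<phi> U = Inv T \<phi> U"
    unfolding Inv_def image_Union by simp
qed

lemma Inv_mono: "U \<subseteq> V \<Longrightarrow> Inv T \<phi> U \<subseteq> Inv T \<phi> V"
  by (auto simp: Inv_def)

lemma Inv_eq_self: "invariant T \<phi> S \<Longrightarrow> Inv T \<phi> S = S"
  by (intro antisym Inv_subset invariant_subset_Inv) auto

lemma invariant_subset_omega_limit:
  assumes "invariant T \<phi> S" "S \<subseteq> U"
  shows "S \<subseteq> omega_limit T \<phi> U"
proof -
  have "S \<subseteq> orbit_tail T \<phi> U t" if "t \<in> nonneg T" for t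
  proof -
    have "S = \<phi> t ` S" using assms(1) that by (simp add: invariant_def)
    then have "S \<subseteq> \<phi> t ` U" using assms(2) by blast
    then show ?thesis using that by (auto simp: orbit_tail_def nonneg_def)
  qed
  then show ?thesis
    unfolding omega_limit_eq using closure_subset by blast
qed

lemma Inv_subset_omega_limit: "Inv T \<phi> U \<subseteq> omega_limit T \<phi> U"
  by (intro invariant_subset_omega_limit invariant_Inv Inv_subset)

lemma invariant_product:
  assumes "invariant T \<phi>\<^sub>1 S\<^sub>1" "invariant T \<phi>\<^sub>2 S\<^sub>2"
  shows "invariant T (product_system \<phi>\<^sub>1 \<phi>\<^sub>2) (S\<^sub>1 \<times> S\<^sub>2)"
  using assms by (simp add: invariant_def product_system_def image_paired_Times)

lemma invariant_projections:
  assumes "invariant T (product_system \<phi>\<^sub>1 \<phi>\<^sub>2) S"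
  shows "invariant T \<phi>\<^sub>1 (fst ` S)" "invariant T \<phi>\<^sub>2 (snd ` S)"
proof -
  have "\<phi>\<^sub>1 t ` fst ` S = fst ` product_system \<phi>\<^sub>1 \<phi>\<^sub>2 t ` S"
    "\<phi>\<^sub>2 t ` snd ` S = snd ` product_system \<phi>\<^sub>1 \<phi>\<^sub>2 t ` S" for t
    unfolding image_image by (auto simp: product_system_def case_prod_beta)
  then show "invariant T \<phi>\<^sub>1 (fst ` S)" "invariant T \<phi>\<^sub>2 (snd ` S)"
    using assms by (simp_all add: invariant_def)
qed

text \<open>Both projections of an invariant set are invariant, so it lies in a product of invariant
  sets, which is itself invariant.\<close>

lemma Inv_Times:
  "Inv T (product_system \<phi>\<^sub>1 \<phi>\<^sub>2) (U\<^sub>1 \<times> U\<^sub>2) = Inv T \<phi>\<^sub>1 U\<^sub>1 \<times> Inv T \<phi>\<^sub>2 U\<^sub>2"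
proof
  show "Inv T \<phi>\<^sub>1 U\<^sub>1 \<times> Inv T \<phi>\<^sub>2 U\<^sub>2 \<subseteq> Inv T (product_system \<phi>\<^sub>1 \<phi>\<^sub>2) (U\<^sub>1 \<times> U\<^sub>2)"
    by (intro invariant_subset_Inv invariant_product invariant_Inv Sigma_mono Inv_subset)
  let ?S = "Inv T (product_system \<phi>\<^sub>1 \<phi>\<^sub>2) (U\<^sub>1 \<times> U\<^sub>2)"
  have "fst ` ?S \<subseteq> U\<^sub>1" "snd ` ?S \<subseteq> U\<^sub>2"
    using Inv_subset[of T "product_system \<phi>\<^sub>1 \<phi>\<^sub>2" "U\<^sub>1 \<times> U\<^sub>2"] by auto
  then have "fst ` ?S \<subseteq> Inv T \<phi>\<^sub>1 U\<^sub>1" "snd ` ?S \<subseteq> Inv T \<phi>\<^sub>2 U\<^sub>2"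
    using invariant_projections[OF invariant_Inv] invariant_subset_Inv by metis+
  then show "?S \<subseteq> Inv T \<phi>\<^sub>1 U\<^sub>1 \<times> Inv T \<phi>\<^sub>2 U\<^sub>2"
    by (auto simp: mem_Times_iff)
qed

section \<open>The lattice of attractors\<close>

lemma dynamical_system_product:
  assumes "dynamical_system T \<phi>\<^sub>1" "dynamical_system T \<phi>\<^sub>2"
  shows "dynamical_system T (product_system \<phi>\<^sub>1 \<phi>\<^sub>2)"
proof -
  have 1: "continuous_on (nonneg T \<times> UNIV) (\<lambda>p. \<phi>\<^sub>1 (fst p) (fst (snd p)))"
    and 2: "continuous_on (nonneg T \<times> UNIV) (\<lambda>p. \<phi>\<^sub>2 (fst p) (snd (snd p)))"
    using assms
      continuous_on_compose2[of "nonneg T \<times> UNIV" "\<lambda>(t, x). \<phi>\<^sub>1 t x" "nonneg T \<times> UNIV"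
        "\<lambda>p. (fst p, fst (snd p))"]
      continuous_on_compose2[of "nonneg T \<times> UNIV" "\<lambda>(t, x). \<phi>\<^sub>2 t x" "nonneg T \<times> UNIV"
        "\<lambda>p. (fst p, snd (snd p))"]
    by (simp_all add: dynamical_system_def continuous_intros image_subset_iff mem_Times_iff)
  have "continuous_on (nonneg T \<times> UNIV) (\<lambda>(t, x). product_system \<phi>\<^sub>1 \<phi>\<^sub>2 t x)"
    using continuous_on_Pair[OF 1 2] by (simp add: product_system_def case_prod_beta)
  then show ?thesis
    using assms by (simp add: dynamical_system_def product_system_def case_prod_beta)
qed

locale compact_dynamical_system =
  fixes T :: "real set" and \<phi> :: "real \<Rightarrow> 'a::metric_space \<Rightarrow> 'a"
  assumes time: "T = \<int> \<or> T = UNIV"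
    and compact: "compact (UNIV :: 'a set)"
    and system: "dynamical_system T \<phi>"
begin

lemma zero_time: "0 \<in> nonneg T"
  and one_time: "1 \<in> T"
  and add_time: "s \<in> T \<Longrightarrow> t \<in> T \<Longrightarrow> s + t \<in> T"
  and diff_time: "s \<in> T \<Longrightarrow> t \<in> T \<Longrightarrow> s - t \<in> T"
  using time by (auto simp: nonneg_def)

lemma continuous_time_map:
  assumes "t \<in> nonneg T"
  shows "continuous_on S (\<phi> t)"
  using system assms continuous_on_compose2[of "nonneg T \<times> UNIV" "\<lambda>(t, x). \<phi> t x" S "\<lambda>x. (t, x)"]
  by (simp add: dynamical_system_def continuous_intros image_subset_iff)

lemma compact_if_closed: "closed (S :: 'a set) \<Longrightarrow> compact S"
  using compact_Int_closed[OF compact] by simp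

lemma image_orbit_tail:
  assumes "r \<in> nonneg T" "t \<in> nonneg T"
  shows "\<phi> r ` orbit_tail T \<phi> U t = orbit_tail T \<phi> U (t + r)"
proof -
  have flow: "\<phi> r (\<phi> s x) = \<phi> (s + r) x" if "s \<in> T" "t \<le> s" for s x
    using system assms that by (auto simp: dynamical_system_def nonneg_def add.commute)
  have "{s \<in> T. t + r \<le> s} = (\<lambda>s. s + r) ` {s \<in> T. t \<le> s}"
  proof -
    have "s \<in> (\<lambda>s. s + r) ` {s \<in> T. t \<le> s}" if "s \<in> T" "t + r \<le> s" for s
      using that assms diff_time[of s r] by (intro image_eqI[of _ _ "s - r"]) (auto simp: nonneg_def)
    then show ?thesis
      using assms add_time by (auto simp: nonneg_def)
  qed
  then show ?thesis
    unfolding orbit_tail_def by (auto simp: image_UN image_image flow)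
qed

lemma image_closure_orbit_tail:
  assumes "r \<in> nonneg T" "t \<in> nonneg T"
  shows "\<phi> r ` closure (orbit_tail T \<phi> U t) = closure (orbit_tail T \<phi> U (t + r))"
proof
  show "\<phi> r ` closure (orbit_tail T \<phi> U t) \<subseteq> closure (orbit_tail T \<phi> U (t + r))"
    using image_closure_subset[OF continuous_time_map[OF assms(1)] closed_closure]
      image_orbit_tail[OF assms, of U] closure_subset by metis
  have "closed (\<phi> r ` closure (orbit_tail T \<phi> U t))"
    using compact_continuous_image[OF continuous_time_map[OF assms(1)]
        compact_if_closed[OF closed_closure]]
    by (rule compact_imp_closed)
  moreover have "orbit_tail T \<phi> U (t + r) \<subseteq> \<phi> r ` closure (orbit_tail T \<phi> U t)"
    unfolding image_orbit_tail[OF assms, symmetric] by (intro image_mono closure_subset)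
  ultimately show "closure (orbit_tail T \<phi> U (t + r)) \<subseteq> \<phi> r ` closure (orbit_tail T \<phi> U t)"
    by (rule closure_minimal[rotated])
qed

text \<open>The map \<open>\<phi> r\<close> carries the nested compact sets \<open>K\<^sub>t\<close> (closed orbit tails) onto \<open>K\<^sub>t\<^sub>+\<^sub>r\<close>,
  which yields forward invariance. For the converse inclusion, the fibre of \<open>\<phi> r\<close> over a limit
  point meets every \<open>K\<^sub>t\<close>, hence by compactness their intersection.\<close>

lemma invariant_omega_limit: "invariant T \<phi> (omega_limit T \<phi> U)"
  unfolding invariant_def
proof (intro ballI antisym)
  fix r assume r: "r \<in> nonneg T"
  let ?K = "\<lambda>t. closure (orbit_tail T \<phi> U t)"
  have K_antimono: "?K t \<subseteq> ?K s" if "s \<le> t" for s t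
    using that by (intro closure_mono orbit_tail_antimono)
  have shift: "\<phi> r ` ?K t = ?K (t + r)" if "t \<in> nonneg T" for t
    using image_closure_orbit_tail[OF r that] .
  have add_r: "t + r \<in> nonneg T" if "t \<in> nonneg T" for t
    using that r add_time by (auto simp: nonneg_def)
  show "\<phi> r ` omega_limit T \<phi> U \<subseteq> omega_limit T \<phi> U"
  proof -
    have "\<phi> r x \<in> ?K t" if "x \<in> omega_limit T \<phi> U" "t \<in> nonneg T" for x t
    proof -
      have "\<phi> r x \<in> ?K (t + r)"
        using that shift[of t] by (auto simp: omega_limit_eq)
      then show ?thesis using K_antimono[of t "t + r"] r by (auto simp: nonneg_def)
    qed
    then show ?thesis by (auto simp: omega_limit_eq)
  qed
  show "omega_limit T \<phi> U \<subseteq> \<phi> r ` omega_limit T \<phi> U"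
  proof
    fix y assume y: "y \<in> omega_limit T \<phi> U"
    let ?P = "\<phi> r -` {y}"
    have "closed ?P"
      using continuous_on_closed_vimage[of UNIV "\<phi> r"] continuous_time_map[OF r] by simp
    have "?P \<inter> (\<Inter>t\<in>nonneg T. ?K t) \<noteq> {}"
    proof (rule compact_imp_fip_image)
      show "compact ?P" using \<open>closed ?P\<close> by (rule compact_if_closed)
      show "closed (?K t)" for t by simp
      fix J assume J: "finite J" "J \<subseteq> nonneg T"
      \<comment> \<open>The time \<open>0\<close> is inserted to cover the case \<open>J = {}\<close>.\<close>
      let ?m = "Max (insert 0 J)"
      have m: "?m \<in> nonneg T"
        using J Max_in[of "insert 0 J"] zero_time
        by (metis finite_insert insert_not_empty insert_subset subsetD)
      then have "y \<in> \<phi> r ` ?K ?m"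
        using y add_r shift by (auto simp: omega_limit_eq)
      then obtain x where "x \<in> ?K ?m" "\<phi> r x = y" by blast
      moreover have "?K ?m \<subseteq> ?K t" if "t \<in> J" for t
        using that J by (intro K_antimono Max_ge) auto
      ultimately show "?P \<inter> (\<Inter>t\<in>J. ?K t) \<noteq> {}" by blast
    qed
    then show "y \<in> \<phi> r ` omega_limit T \<phi> U"
      by (auto simp: omega_limit_eq)
  qed
qed

lemma omega_limit_eq_Inv: "omega_limit T \<phi> U \<subseteq> U \<Longrightarrow> omega_limit T \<phi> U = Inv T \<phi> U"
  by (intro antisym Inv_subset_omega_limit invariant_subset_Inv invariant_omega_limit)

text \<open>The limit set lies in \<open>closure U\<close>, and being invariant it equals its image at the
  time \<open>\<tau>\<close>, which lies in \<open>interior U\<close>.\<close>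

lemma omega_limit_attracting_nbhd:
  assumes "attracting_nbhd T \<phi> U"
  shows "omega_limit T \<phi> U = Inv T \<phi> U"
proof (rule omega_limit_eq_Inv)
  obtain \<tau> where \<tau>: "\<tau> \<in> T" "\<tau> > 0" and attr: "\<And>t. t \<in> T \<Longrightarrow> \<tau> \<le> t \<Longrightarrow> \<phi> t ` closure U \<subseteq> interior U"
    using assms by (auto simp: attracting_nbhd_def)
  have nonneg: "\<tau> \<in> nonneg T" using \<tau> by (simp add: nonneg_def)
  have "orbit_tail T \<phi> U \<tau> \<subseteq> U"
    unfolding orbit_tail_def using attr closure_subset[of U] interior_subset[of U] by blast
  then have "omega_limit T \<phi> U \<subseteq> closure U"
    unfolding omega_limit_eq using nonneg closure_mono by blast
  moreover have "\<phi> \<tau> ` omega_limit T \<phi> U = omega_limit T \<phi> U"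
    using invariant_omega_limit nonneg by (simp add: invariant_def)
  ultimately show "omega_limit T \<phi> U \<subseteq> U"
    using attr[OF \<tau>(1)] interior_subset[of U] by blast
qed

lemma attracting_nbhd_Int:
  assumes "attracting_nbhd T \<phi> U" "attracting_nbhd T \<phi> V"
  shows "attracting_nbhd T \<phi> (U \<inter> V)"
proof -
  obtain \<sigma> \<tau> where "\<sigma> \<in> T" "\<sigma> > 0" "\<tau> \<in> T" "\<tau> > 0"
    and U: "\<And>t. t \<in> T \<Longrightarrow> \<sigma> \<le> t \<Longrightarrow> \<phi> t ` closure U \<subseteq> interior U"
    and V: "\<And>t. t \<in> T \<Longrightarrow> \<tau> \<le> t \<Longrightarrow> \<phi> t ` closure V \<subseteq> interior V"
    using assms by (auto simp: attracting_nbhd_def)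
  moreover have "\<phi> t ` closure (U \<inter> V) \<subseteq> interior (U \<inter> V)" if "t \<in> T" "max \<sigma> \<tau> \<le> t" for t
    using U[of t] V[of t] that closure_mono[of "U \<inter> V" U] closure_mono[of "U \<inter> V" V]
    by (simp add: interior_Int) blast
  ultimately show ?thesis
    unfolding attracting_nbhd_def by (intro bexI[of _ "max \<sigma> \<tau>"]) (auto simp: max_def)
qed

lemma attracting_nbhd_Un:
  assumes "attracting_nbhd T \<phi> U" "attracting_nbhd T \<phi> V"
  shows "attracting_nbhd T \<phi> (U \<union> V)"
proof -
  obtain \<sigma> \<tau> where "\<sigma> \<in> T" "\<sigma> > 0" "\<tau> \<in> T" "\<tau> > 0"
    and U: "\<And>t. t \<in> T \<Longrightarrow> \<sigma> \<le> t \<Longrightarrow> \<phi> t ` closure U \<subseteq> interior U"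
    and V: "\<And>t. t \<in> T \<Longrightarrow> \<tau> \<le> t \<Longrightarrow> \<phi> t ` closure V \<subseteq> interior V"
    using assms by (auto simp: attracting_nbhd_def)
  moreover have "\<phi> t ` closure (U \<union> V) \<subseteq> interior (U \<union> V)" if "t \<in> T" "max \<sigma> \<tau> \<le> t" for t
    using U[of t] V[of t] that interior_mono[of U "U \<union> V"] interior_mono[of V "U \<union> V"]
    by (simp add: image_Un) blast
  ultimately show ?thesis
    unfolding attracting_nbhd_def by (intro bexI[of _ "max \<sigma> \<tau>"]) (auto simp: max_def)
qed

lemma attracting_nbhd_trivial: "attracting_nbhd T \<phi> {}" "attracting_nbhd T \<phi> UNIV"
  using one_time by (auto simp: attracting_nbhd_def intro!: bexI[of _ 1])

lemma attractorE:
  assumes "A \<in> attractors T \<phi>"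
  obtains U where "attracting_nbhd T \<phi> U" "A = omega_limit T \<phi> U" "A = Inv T \<phi> U"
  using assms omega_limit_attracting_nbhd by (auto simp: attractors_def)

lemma attractorI: "attracting_nbhd T \<phi> U \<Longrightarrow> omega_limit T \<phi> U \<in> attractors T \<phi>"
  by (auto simp: attractors_def)

lemma invariant_attractor: "A \<in> attractors T \<phi> \<Longrightarrow> invariant T \<phi> A"
  by (metis attractorE invariant_Inv)

lemma closed_attractor: "A \<in> attractors T \<phi> \<Longrightarrow> closed A"
  by (metis attractorE closed_omega_limit)

lemma omega_limit_closed_forward_invariant:
  assumes "closed Y" "\<And>t. t \<in> nonneg T \<Longrightarrow> \<phi> t ` Y \<subseteq> Y"
  shows "omega_limit T \<phi> Y = Inv T \<phi> Y"
proof (rule omega_limit_eq_Inv)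
  have "orbit_tail T \<phi> Y 0 \<subseteq> Y"
    using assms(2) by (auto simp: orbit_tail_def nonneg_def)
  then have "closure (orbit_tail T \<phi> Y 0) \<subseteq> Y"
    using assms(1) by (rule closure_minimal)
  then show "omega_limit T \<phi> Y \<subseteq> Y"
    using zero_time by (auto simp: omega_limit_eq)
qed

lemma omega_limit_Int_attractors:
  assumes "A \<in> attractors T \<phi>" "B \<in> attractors T \<phi>"
  shows "omega_limit T \<phi> (A \<inter> B) = Inv T \<phi> (A \<inter> B)"
proof (rule omega_limit_closed_forward_invariant)
  show "closed (A \<inter> B)"
    using assms closed_attractor by blast
  show "\<phi> t ` (A \<inter> B) \<subseteq> A \<inter> B" if "t \<in> nonneg T" for t
    using that assms[THEN invariant_attractor] unfolding invariant_def by blast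
qed

lemma attractors_Un:
  assumes "A \<in> attractors T \<phi>" "B \<in> attractors T \<phi>"
  shows "A \<union> B \<in> attractors T \<phi>"
proof -
  obtain U V where "attracting_nbhd T \<phi> U" "attracting_nbhd T \<phi> V"
    "A = omega_limit T \<phi> U" "B = omega_limit T \<phi> V"
    using assms by (meson attractorE)
  then show ?thesis
    by (metis attracting_nbhd_Un attractorI omega_limit_Un)
qed

text \<open>If \<open>U\<close> and \<open>V\<close> are attracting neighborhoods of \<open>A\<close> and \<open>B\<close>, then \<open>U \<inter> V\<close> has the
  same invariant subsets as \<open>A \<inter> B\<close>.\<close>

lemma attractors_meet:
  assumes "A \<in> attractors T \<phi>" "B \<in> attractors T \<phi>"
  shows "Inv T \<phi> (A \<inter> B) \<in> attractors T \<phi>"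
proof -
  obtain U V where U: "attracting_nbhd T \<phi> U" "A = Inv T \<phi> U"
    and V: "attracting_nbhd T \<phi> V" "B = Inv T \<phi> V"
    using assms by (meson attractorE)
  have "Inv T \<phi> (U \<inter> V) \<subseteq> A \<inter> B"
    unfolding U(2) V(2) by (simp add: Inv_mono)
  then have "Inv T \<phi> (U \<inter> V) \<subseteq> Inv T \<phi> (A \<inter> B)"
    by (intro invariant_subset_Inv invariant_Inv)
  moreover have "A \<inter> B \<subseteq> U \<inter> V"
    unfolding U(2) V(2) using Inv_subset by (meson Int_mono)
  ultimately have "Inv T \<phi> (A \<inter> B) = Inv T \<phi> (U \<inter> V)"
    using Inv_mono by (metis antisym)
  also have "\<dots> = omega_limit T \<phi> (U \<inter> V)"
    by (rule omega_limit_attracting_nbhd[OF attracting_nbhd_Int[OF U(1) V(1)], symmetric])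
  finally show ?thesis
    using attractorI[OF attracting_nbhd_Int[OF U(1) V(1)]] by simp
qed

lemma empty_attractor: "{} \<in> attractors T \<phi>"
  using attractorI[OF attracting_nbhd_trivial(1)] zero_time omega_limit_empty[of T \<phi>]
  by (metis empty_iff)

lemma Inv_UNIV_attractor: "Inv T \<phi> UNIV \<in> attractors T \<phi>"
  using attractorI[OF attracting_nbhd_trivial(2)] omega_limit_attracting_nbhd attracting_nbhd_trivial
  by metis

lemma attractor_subset_Inv_UNIV: "A \<in> attractors T \<phi> \<Longrightarrow> A \<subseteq> Inv T \<phi> UNIV"
  by (intro invariant_subset_Inv invariant_attractor) auto

lemma Att_carrier: "carrier (Att T \<phi>) = attractors T \<phi>"
  and Att_join: "A \<squnion>\<^bsub>Att T \<phi>\<^esub> B = A \<union> B"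
  and Att_meet: "A \<in> attractors T \<phi> \<Longrightarrow> B \<in> attractors T \<phi> \<Longrightarrow> A \<sqinter>\<^bsub>Att T \<phi>\<^esub> B = Inv T \<phi> (A \<inter> B)"
  and Att_least: "\<bottom>\<^bsub>Att T \<phi>\<^esub> = {}"
  and Att_greatest: "\<top>\<^bsub>Att T \<phi>\<^esub> = Inv T \<phi> UNIV"
  by (simp_all add: Att_def omega_limit_Int_attractors)

lemmas Att_simps = Att_carrier Att_join Att_meet Att_least Att_greatest

lemma Inv_Int_Inv: "Inv T \<phi> (Inv T \<phi> U \<inter> V) = Inv T \<phi> (U \<inter> V)"
proof
  show "Inv T \<phi> (Inv T \<phi> U \<inter> V) \<subseteq> Inv T \<phi> (U \<inter> V)"
    using Inv_subset[of T \<phi> U] by (intro Inv_mono) auto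
  show "Inv T \<phi> (U \<inter> V) \<subseteq> Inv T \<phi> (Inv T \<phi> U \<inter> V)"
    using Inv_mono[of "U \<inter> V" U] Inv_subset[of T \<phi> "U \<inter> V"]
    by (intro invariant_subset_Inv invariant_Inv) auto
qed

lemma bdl_Att: "bdl (Att T \<phi>)"
proof
  fix A B C
  assume "A \<in> carrier (Att T \<phi>)"
  then have A: "A \<in> attractors T \<phi>" by (simp add: Att_carrier)
  then have Inv_A: "Inv T \<phi> A = A"
    by (simp add: Inv_eq_self invariant_attractor)
  show "A \<squnion>\<^bsub>Att T \<phi>\<^esub> \<bottom>\<^bsub>Att T \<phi>\<^esub> = A"
    by (simp add: Att_simps)
  show "A \<sqinter>\<^bsub>Att T \<phi>\<^esub> \<top>\<^bsub>Att T \<phi>\<^esub> = A"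
    using A attractor_subset_Inv_UNIV[OF A]
    by (simp add: Att_simps Inv_UNIV_attractor Int_absorb2 Inv_A)
  assume "B \<in> carrier (Att T \<phi>)"
  then have B: "B \<in> attractors T \<phi>" by (simp add: Att_carrier)
  show "A \<squnion>\<^bsub>Att T \<phi>\<^esub> B \<in> carrier (Att T \<phi>)" "A \<sqinter>\<^bsub>Att T \<phi>\<^esub> B \<in> carrier (Att T \<phi>)"
    "A \<squnion>\<^bsub>Att T \<phi>\<^esub> B = B \<squnion>\<^bsub>Att T \<phi>\<^esub> A" "A \<sqinter>\<^bsub>Att T \<phi>\<^esub> B = B \<sqinter>\<^bsub>Att T \<phi>\<^esub> A"
    using A B by (simp_all add: Att_simps attractors_Un attractors_meet Un_commute Int_commute)
  show "A \<squnion>\<^bsub>Att T \<phi>\<^esub> (A \<sqinter>\<^bsub>Att T \<phi>\<^esub> B) = A"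
    using A B Inv_subset[of T \<phi> "A \<inter> B"] by (auto simp: Att_simps)
  show "A \<sqinter>\<^bsub>Att T \<phi>\<^esub> (A \<squnion>\<^bsub>Att T \<phi>\<^esub> B) = A"
    using A B by (simp add: Att_simps attractors_Un Inv_A Int_absorb2)
  assume "C \<in> carrier (Att T \<phi>)"
  then have C: "C \<in> attractors T \<phi>" by (simp add: Att_carrier)
  show "(A \<squnion>\<^bsub>Att T \<phi>\<^esub> B) \<squnion>\<^bsub>Att T \<phi>\<^esub> C = A \<squnion>\<^bsub>Att T \<phi>\<^esub> (B \<squnion>\<^bsub>Att T \<phi>\<^esub> C)"
    by (simp add: Att_simps Un_assoc)
  show "(A \<sqinter>\<^bsub>Att T \<phi>\<^esub> B) \<sqinter>\<^bsub>Att T \<phi>\<^esub> C = A \<sqinter>\<^bsub>Att T \<phi>\<^esub> (B \<sqinter>\<^bsub>Att T \<phi>\<^esub> C)"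
    using A B C Inv_Int_Inv[of "A \<inter> B" C] Inv_Int_Inv[of "B \<inter> C" A]
    by (simp add: Att_simps attractors_meet Int_ac)
  \<comment> \<open>Here the description of the meet by \<open>\<omega>\<close> is the useful one: \<open>Inv\<close> does not commute
    with unions in general, whereas \<open>\<omega>\<close> does.\<close>
  show "A \<sqinter>\<^bsub>Att T \<phi>\<^esub> (B \<squnion>\<^bsub>Att T \<phi>\<^esub> C) = (A \<sqinter>\<^bsub>Att T \<phi>\<^esub> B) \<squnion>\<^bsub>Att T \<phi>\<^esub> (A \<sqinter>\<^bsub>Att T \<phi>\<^esub> C)"
    by (simp add: Att_def Int_Un_distrib omega_limit_Un)
qed (simp_all add: Att_simps empty_attractor Inv_UNIV_attractor)

end

section \<open>Attractors of the product system\<close>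

lemma attracting_nbhd_Times:
  assumes T: "T = \<int> \<or> T = UNIV"
    and "attracting_nbhd T \<phi>\<^sub>1 U\<^sub>1" "attracting_nbhd T \<phi>\<^sub>2 U\<^sub>2"
  shows "attracting_nbhd T (product_system \<phi>\<^sub>1 \<phi>\<^sub>2) (U\<^sub>1 \<times> U\<^sub>2)"
proof -
  obtain \<sigma> \<tau> where "\<sigma> \<in> T" "\<sigma> > 0" "\<tau> \<in> T" "\<tau> > 0"
    and U\<^sub>1: "\<And>t. t \<in> T \<Longrightarrow> \<sigma> \<le> t \<Longrightarrow> \<phi>\<^sub>1 t ` closure U\<^sub>1 \<subseteq> interior U\<^sub>1"
    and U\<^sub>2: "\<And>t. t \<in> T \<Longrightarrow> \<tau> \<le> t \<Longrightarrow> \<phi>\<^sub>2 t ` closure U\<^sub>2 \<subseteq> interior U\<^sub>2"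
    using assms by (auto simp: attracting_nbhd_def)
  moreover have "product_system \<phi>\<^sub>1 \<phi>\<^sub>2 t ` closure (U\<^sub>1 \<times> U\<^sub>2) \<subseteq> interior (U\<^sub>1 \<times> U\<^sub>2)"
    if "t \<in> T" "max \<sigma> \<tau> \<le> t" for t
    using U\<^sub>1[of t] U\<^sub>2[of t] that
    by (auto simp: product_system_def closure_Times interior_Times)
  ultimately show ?thesis
    unfolding attracting_nbhd_def by (intro bexI[of _ "max \<sigma> \<tau>"]) (auto simp: max_def)
qed

locale compact_product_system =
  S1: compact_dynamical_system T \<phi>\<^sub>1 + S2: compact_dynamical_system T \<phi>\<^sub>2
  for T :: "real set" and \<phi>\<^sub>1 :: "real \<Rightarrow> 'a::metric_space \<Rightarrow> 'a"
    and \<phi>\<^sub>2 :: "real \<Rightarrow> 'b::metric_space \<Rightarrow> 'b"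
begin

abbreviation "\<Phi> \<equiv> product_system \<phi>\<^sub>1 \<phi>\<^sub>2"
abbreviation "I\<^sub>1 \<equiv> Inv T \<phi>\<^sub>1 UNIV"
abbreviation "I\<^sub>2 \<equiv> Inv T \<phi>\<^sub>2 UNIV"

sublocale P: compact_dynamical_system T \<Phi>
proof
  show "compact (UNIV :: ('a \<times> 'b) set)"
    using compact_Times[OF S1.compact S2.compact] by simp
qed (use S1.time dynamical_system_product[OF S1.system S2.system] in auto)

lemma attractor_Times:
  assumes "A \<in> attractors T \<phi>\<^sub>1" "B \<in> attractors T \<phi>\<^sub>2"
  shows "A \<times> B \<in> attractors T \<Phi>"
proof -
  obtain U V where U: "attracting_nbhd T \<phi>\<^sub>1 U" "A = Inv T \<phi>\<^sub>1 U"
    and V: "attracting_nbhd T \<phi>\<^sub>2 V" "B = Inv T \<phi>\<^sub>2 V"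
    using assms by (meson S1.attractorE S2.attractorE)
  have nbhd: "attracting_nbhd T \<Phi> (U \<times> V)"
    using U V by (intro attracting_nbhd_Times S1.time)
  then have "omega_limit T \<Phi> (U \<times> V) = A \<times> B"
    by (simp add: P.omega_limit_attracting_nbhd Inv_Times U(2) V(2))
  then show ?thesis using P.attractorI[OF nbhd] by simp
qed

lemma meet_Times:
  assumes "A \<in> attractors T \<phi>\<^sub>1" "B \<in> attractors T \<phi>\<^sub>2" "C \<in> attractors T \<phi>\<^sub>1" "D \<in> attractors T \<phi>\<^sub>2"
  shows "(A \<times> B) \<sqinter>\<^bsub>Att T \<Phi>\<^esub> (C \<times> D) = (A \<sqinter>\<^bsub>Att T \<phi>\<^sub>1\<^esub> C) \<times> (B \<sqinter>\<^bsub>Att T \<phi>\<^sub>2\<^esub> D)"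
  using assms
  by (simp add: P.Att_meet S1.Att_meet S2.Att_meet attractor_Times Times_Int_Times Inv_Times)

lemma greatest_Times: "\<top>\<^bsub>Att T \<Phi>\<^esub> = I\<^sub>1 \<times> I\<^sub>2"
  by (simp add: P.Att_greatest flip: Inv_Times UNIV_Times_UNIV)

lemma top_attractors: "I\<^sub>1 \<in> attractors T \<phi>\<^sub>1" "I\<^sub>2 \<in> attractors T \<phi>\<^sub>2"
  by (rule S1.Inv_UNIV_attractor S2.Inv_UNIV_attractor)+

interpretation A1: bdl "Att T \<phi>\<^sub>1" by (rule S1.bdl_Att)
interpretation A2: bdl "Att T \<phi>\<^sub>2" by (rule S2.bdl_Att)
interpretation AP: bdl "Att T \<Phi>" by (rule P.bdl_Att)

lemma meet_top:
  "A \<in> attractors T \<phi>\<^sub>1 \<Longrightarrow> A \<sqinter>\<^bsub>Att T \<phi>\<^sub>1\<^esub> I\<^sub>1 = A" "A \<in> attractors T \<phi>\<^sub>1 \<Longrightarrow> I\<^sub>1 \<sqinter>\<^bsub>Att T \<phi>\<^sub>1\<^esub> A = A"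
  "B \<in> attractors T \<phi>\<^sub>2 \<Longrightarrow> B \<sqinter>\<^bsub>Att T \<phi>\<^sub>2\<^esub> I\<^sub>2 = B" "B \<in> attractors T \<phi>\<^sub>2 \<Longrightarrow> I\<^sub>2 \<sqinter>\<^bsub>Att T \<phi>\<^sub>2\<^esub> B = B"
  using A1.meet_greatest[of A] A1.meet_commute[of I\<^sub>1 A] A2.meet_greatest[of B]
    A2.meet_commute[of I\<^sub>2 B] top_attractors
  by (simp_all add: S1.Att_carrier S2.Att_carrier S1.Att_greatest S2.Att_greatest)

lemma strips_meet:
  assumes "A \<in> attractors T \<phi>\<^sub>1" "B \<in> attractors T \<phi>\<^sub>2"
  shows "(A \<times> I\<^sub>2) \<sqinter>\<^bsub>Att T \<Phi>\<^esub> (I\<^sub>1 \<times> B) = A \<times> B"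
  using assms by (simp add: meet_Times top_attractors meet_top)

text \<open>A point of \<open>A - C\<close> paired with a point of \<open>B - D\<close> would lie in neither strip.\<close>

lemma strips_independent:
  assumes "A \<times> B \<subseteq> (C \<times> I\<^sub>2) \<union> (I\<^sub>1 \<times> D)"
  shows "A \<subseteq> C \<or> B \<subseteq> D"
  using assms by blast

lemma L_meet_subset: "L_meet T \<phi>\<^sub>1 \<phi>\<^sub>2 \<subseteq> carrier (Att T \<Phi>)"
  by (auto simp: L_meet_def P.Att_carrier attractor_Times)

text \<open>Rectangles are closed under meets, which are computed factorwise, so their finite joins
  form a sublattice.\<close>

lemma bdl_L_meet_join: "bdl (L_meet_join T \<phi>\<^sub>1 \<phi>\<^sub>2)"
  unfolding L_meet_join_def
proof (rule AP.bdl_sublattice)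
  have "I\<^sub>1 \<times> I\<^sub>2 \<in> L_meet T \<phi>\<^sub>1 \<phi>\<^sub>2"
    using top_attractors by (auto simp: L_meet_def)
  then show "\<top>\<^bsub>Att T \<Phi>\<^esub> \<in> join_closure (Att T \<Phi>) (L_meet T \<phi>\<^sub>1 \<phi>\<^sub>2)"
    by (simp add: greatest_Times join_closure.base)
  have "s \<sqinter>\<^bsub>Att T \<Phi>\<^esub> t \<in> L_meet T \<phi>\<^sub>1 \<phi>\<^sub>2" if s: "s \<in> L_meet T \<phi>\<^sub>1 \<phi>\<^sub>2" and t: "t \<in> L_meet T \<phi>\<^sub>1 \<phi>\<^sub>2" for s t
  proof -
    obtain A B C D where "A \<in> attractors T \<phi>\<^sub>1" "B \<in> attractors T \<phi>\<^sub>2"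
      "C \<in> attractors T \<phi>\<^sub>1" "D \<in> attractors T \<phi>\<^sub>2" "s = A \<times> B" "t = C \<times> D"
      using s t unfolding L_meet_def by blast
    then show ?thesis
      using A1.meet_closed[of A C] A2.meet_closed[of B D]
      by (auto simp: meet_Times L_meet_def S1.Att_carrier S2.Att_carrier)
  qed
  then show "x \<sqinter>\<^bsub>Att T \<Phi>\<^esub> y \<in> join_closure (Att T \<Phi>) (L_meet T \<phi>\<^sub>1 \<phi>\<^sub>2)"
    if "x \<in> join_closure (Att T \<Phi>) (L_meet T \<phi>\<^sub>1 \<phi>\<^sub>2)" "y \<in> join_closure (Att T \<Phi>) (L_meet T \<phi>\<^sub>1 \<phi>\<^sub>2)" for x y
    using that by (intro AP.join_closure_meet[OF L_meet_subset])
qed (auto intro: join_closure.empty join_closure.join AP.join_closure_carrier[OF L_meet_subset])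

text \<open>A strip determined by \<open>A\<close> keeps the maximal attractor in the other factor; this is what
  sends the top element to the top element.\<close>

lemma strip_homs:
  "(\<lambda>A. A \<times> I\<^sub>2) \<in> bdl_hom (Att T \<phi>\<^sub>1) (Att T \<Phi>)" "(\<lambda>B. I\<^sub>1 \<times> B) \<in> bdl_hom (Att T \<phi>\<^sub>2) (Att T \<Phi>)"
  using top_attractors
  by (auto simp: bdl_hom_def S1.Att_carrier S2.Att_carrier P.Att_carrier attractor_Times meet_Times
      meet_top S1.Att_join S2.Att_join P.Att_join S1.Att_least S2.Att_least P.Att_least
      S1.Att_greatest S2.Att_greatest greatest_Times)

lemma strip_lattices:
  "L1 T \<phi>\<^sub>1 \<phi>\<^sub>2 = (Att T \<Phi>)\<lparr>carrier := (\<lambda>A. A \<times> I\<^sub>2) ` carrier (Att T \<phi>\<^sub>1)\<rparr>"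
  "L2 T \<phi>\<^sub>1 \<phi>\<^sub>2 = (Att T \<Phi>)\<lparr>carrier := (\<lambda>B. I\<^sub>1 \<times> B) ` carrier (Att T \<phi>\<^sub>2)\<rparr>"
  by (auto simp: L1_def L2_def S1.Att_carrier S2.Att_carrier
      intro!: arg_cong[where f = "\<lambda>K. _\<lparr>carrier := K\<rparr>"])

lemma bdl_strip_lattices: "bdl (L1 T \<phi>\<^sub>1 \<phi>\<^sub>2)" "bdl (L2 T \<phi>\<^sub>1 \<phi>\<^sub>2)"
  unfolding strip_lattices
  by (rule bdl_hom_image[OF S1.bdl_Att P.bdl_Att strip_homs(1)]
      bdl_hom_image[OF S2.bdl_Att P.bdl_Att strip_homs(2)])+

lemma strips_in_L_meet:
  "A \<in> attractors T \<phi>\<^sub>1 \<Longrightarrow> A \<times> I\<^sub>2 \<in> L_meet T \<phi>\<^sub>1 \<phi>\<^sub>2"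
  "B \<in> attractors T \<phi>\<^sub>2 \<Longrightarrow> I\<^sub>1 \<times> B \<in> L_meet T \<phi>\<^sub>1 \<phi>\<^sub>2"
  using top_attractors by (auto simp: L_meet_def)

lemma L_meet_eq_strips_meet:
  "L_meet T \<phi>\<^sub>1 \<phi>\<^sub>2 = {(A \<times> I\<^sub>2) \<sqinter>\<^bsub>Att T \<Phi>\<^esub> (I\<^sub>1 \<times> B) | A B.
     A \<in> attractors T \<phi>\<^sub>1 \<and> B \<in> attractors T \<phi>\<^sub>2}"
proof (intro set_eqI iffI)
  fix S assume "S \<in> L_meet T \<phi>\<^sub>1 \<phi>\<^sub>2"
  then obtain A B where "A \<in> attractors T \<phi>\<^sub>1" "B \<in> attractors T \<phi>\<^sub>2" "S = A \<times> B"
    unfolding L_meet_def by blast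
  then show "S \<in> {(A \<times> I\<^sub>2) \<sqinter>\<^bsub>Att T \<Phi>\<^esub> (I\<^sub>1 \<times> B) | A B.
     A \<in> attractors T \<phi>\<^sub>1 \<and> B \<in> attractors T \<phi>\<^sub>2}"
    using strips_meet[of A B] by blast
next
  fix S assume "S \<in> {(A \<times> I\<^sub>2) \<sqinter>\<^bsub>Att T \<Phi>\<^esub> (I\<^sub>1 \<times> B) | A B.
     A \<in> attractors T \<phi>\<^sub>1 \<and> B \<in> attractors T \<phi>\<^sub>2}"
  then obtain A B where "A \<in> attractors T \<phi>\<^sub>1" "B \<in> attractors T \<phi>\<^sub>2" "S = A \<times> B"
    using strips_meet by auto
  then show "S \<in> L_meet T \<phi>\<^sub>1 \<phi>\<^sub>2"
    unfolding L_meet_def by blast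
qed

lemma L_meet_join_simps:
  "carrier (L_meet_join T \<phi>\<^sub>1 \<phi>\<^sub>2) = join_closure (L_meet_join T \<phi>\<^sub>1 \<phi>\<^sub>2) (L_meet T \<phi>\<^sub>1 \<phi>\<^sub>2)"
  "X \<squnion>\<^bsub>L_meet_join T \<phi>\<^sub>1 \<phi>\<^sub>2\<^esub> Y = X \<union> Y"
  "meet (L_meet_join T \<phi>\<^sub>1 \<phi>\<^sub>2) = meet (Att T \<Phi>)"
  "below (L_meet_join T \<phi>\<^sub>1 \<phi>\<^sub>2) X Y \<longleftrightarrow> X \<subseteq> Y"
  by (simp_all add: L_meet_join_def join_closure_update_carrier below_def P.Att_join subset_Un_eq)

lemma L_meet_join_iso_Att_coproduct:
  "L_meet_join T \<phi>\<^sub>1 \<phi>\<^sub>2 \<cong> Att T \<phi>\<^sub>1 \<amalg> Att T \<phi>\<^sub>2"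
proof (rule coproduct_iso_if_independent[OF S1.bdl_Att S2.bdl_Att bdl_L_meet_join])
  show "(\<lambda>A. A \<times> I\<^sub>2) \<in> bdl_hom (Att T \<phi>\<^sub>1) (L_meet_join T \<phi>\<^sub>1 \<phi>\<^sub>2)"
    "(\<lambda>B. I\<^sub>1 \<times> B) \<in> bdl_hom (Att T \<phi>\<^sub>2) (L_meet_join T \<phi>\<^sub>1 \<phi>\<^sub>2)"
    unfolding L_meet_join_def
    by (auto simp: S1.Att_carrier S2.Att_carrier
        intro!: bdl_hom_restrict strip_homs join_closure.base strips_in_L_meet)
  show "carrier (L_meet_join T \<phi>\<^sub>1 \<phi>\<^sub>2) \<subseteq> join_closure (L_meet_join T \<phi>\<^sub>1 \<phi>\<^sub>2)
      {(A \<times> I\<^sub>2) \<sqinter>\<^bsub>L_meet_join T \<phi>\<^sub>1 \<phi>\<^sub>2\<^esub> (I\<^sub>1 \<times> B) | A B.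
       A \<in> carrier (Att T \<phi>\<^sub>1) \<and> B \<in> carrier (Att T \<phi>\<^sub>2)}"
    unfolding L_meet_join_simps(1,3) L_meet_eq_strips_meet S1.Att_carrier S2.Att_carrier
    by (rule order_refl)
next
  fix A B C D
  assume attr: "A \<in> carrier (Att T \<phi>\<^sub>1)" "B \<in> carrier (Att T \<phi>\<^sub>2)"
    and "below (L_meet_join T \<phi>\<^sub>1 \<phi>\<^sub>2) ((A \<times> I\<^sub>2) \<sqinter>\<^bsub>L_meet_join T \<phi>\<^sub>1 \<phi>\<^sub>2\<^esub> (I\<^sub>1 \<times> B))
      ((C \<times> I\<^sub>2) \<squnion>\<^bsub>L_meet_join T \<phi>\<^sub>1 \<phi>\<^sub>2\<^esub> (I\<^sub>1 \<times> D))"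
  then have "A \<times> B \<subseteq> (C \<times> I\<^sub>2) \<union> (I\<^sub>1 \<times> D)"
    by (simp add: L_meet_join_simps strips_meet S1.Att_carrier S2.Att_carrier)
  then show "below (Att T \<phi>\<^sub>1) A C \<or> below (Att T \<phi>\<^sub>2) B D"
    using strips_independent by (auto simp: below_def S1.Att_join S2.Att_join)
qed

text \<open>The strips are themselves members of \<open>L_meet_join\<close>, so both homomorphisms are inclusions.\<close>

lemma L_meet_join_iso_strip_coproduct:
  "L_meet_join T \<phi>\<^sub>1 \<phi>\<^sub>2 \<cong> L1 T \<phi>\<^sub>1 \<phi>\<^sub>2 \<amalg> L2 T \<phi>\<^sub>1 \<phi>\<^sub>2"
proof (rule coproduct_iso_if_independent[OF bdl_strip_lattices bdl_L_meet_join])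
  show "(\<lambda>X. X) \<in> bdl_hom (L1 T \<phi>\<^sub>1 \<phi>\<^sub>2) (L_meet_join T \<phi>\<^sub>1 \<phi>\<^sub>2)"
    "(\<lambda>X. X) \<in> bdl_hom (L2 T \<phi>\<^sub>1 \<phi>\<^sub>2) (L_meet_join T \<phi>\<^sub>1 \<phi>\<^sub>2)"
    by (auto simp: bdl_hom_def L1_def L2_def L_meet_join_def
        intro: join_closure.base strips_in_L_meet)
  show "carrier (L_meet_join T \<phi>\<^sub>1 \<phi>\<^sub>2) \<subseteq> join_closure (L_meet_join T \<phi>\<^sub>1 \<phi>\<^sub>2)
      {X \<sqinter>\<^bsub>L_meet_join T \<phi>\<^sub>1 \<phi>\<^sub>2\<^esub> Y | X Y.
       X \<in> carrier (L1 T \<phi>\<^sub>1 \<phi>\<^sub>2) \<and> Y \<in> carrier (L2 T \<phi>\<^sub>1 \<phi>\<^sub>2)}" (is "_ \<subseteq> join_closure _ ?R")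
  proof -
    have "?R = L_meet T \<phi>\<^sub>1 \<phi>\<^sub>2"
      unfolding L_meet_join_simps(3) L_meet_eq_strips_meet by (auto simp: L1_def L2_def)
    then show ?thesis by (simp add: L_meet_join_simps(1))
  qed
next
  fix X Y X' Y'
  assume "X \<in> carrier (L1 T \<phi>\<^sub>1 \<phi>\<^sub>2)" "X' \<in> carrier (L1 T \<phi>\<^sub>1 \<phi>\<^sub>2)"
    "Y \<in> carrier (L2 T \<phi>\<^sub>1 \<phi>\<^sub>2)" "Y' \<in> carrier (L2 T \<phi>\<^sub>1 \<phi>\<^sub>2)"
    and le: "below (L_meet_join T \<phi>\<^sub>1 \<phi>\<^sub>2) (X \<sqinter>\<^bsub>L_meet_join T \<phi>\<^sub>1 \<phi>\<^sub>2\<^esub> Y)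
      (X' \<squnion>\<^bsub>L_meet_join T \<phi>\<^sub>1 \<phi>\<^sub>2\<^esub> Y')"
  then obtain A B C D where attr: "A \<in> attractors T \<phi>\<^sub>1" "B \<in> attractors T \<phi>\<^sub>2"
    and eq: "X = A \<times> I\<^sub>2" "X' = C \<times> I\<^sub>2" "Y = I\<^sub>1 \<times> B" "Y' = I\<^sub>1 \<times> D"
    by (auto simp: L1_def L2_def)
  have "A \<times> B \<subseteq> (C \<times> I\<^sub>2) \<union> (I\<^sub>1 \<times> D)"
    using le attr by (simp add: eq L_meet_join_simps strips_meet)
  then have "X \<subseteq> X' \<or> Y \<subseteq> Y'"
    using strips_independent unfolding eq by blast
  then show "below (L1 T \<phi>\<^sub>1 \<phi>\<^sub>2) X X' \<or> below (L2 T \<phi>\<^sub>1 \<phi>\<^sub>2) Y Y'"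
    by (auto simp: below_def L1_def L2_def Att_def)
qed

end

theorem proposition4p4:
  fixes T :: "real set"
    and \<phi>\<^sub>1 :: "real \<Rightarrow> 'a::metric_space \<Rightarrow> 'a"
    and \<phi>\<^sub>2 :: "real \<Rightarrow> 'b::metric_space \<Rightarrow> 'b"
  assumes "T = \<int> \<or> T = UNIV"
    and "compact (UNIV :: 'a set)"
    and "compact (UNIV :: 'b set)"
    and "dynamical_system T \<phi>\<^sub>1"
    and "dynamical_system T \<phi>\<^sub>2"
  shows "L_meet_join T \<phi>\<^sub>1 \<phi>\<^sub>2 \<cong> L1 T \<phi>\<^sub>1 \<phi>\<^sub>2 \<amalg> L2 T \<phi>\<^sub>1 \<phi>\<^sub>2 \<and>
    L1 T \<phi>\<^sub>1 \<phi>\<^sub>2 \<amalg> L2 T \<phi>\<^sub>1 \<phi>\<^sub>2 \<cong> Att T \<phi>\<^sub>1 \<amalg> Att T \<phi>\<^sub>2"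
proof -
  interpret compact_product_system T \<phi>\<^sub>1 \<phi>\<^sub>2
    using assms by unfold_locales
  show ?thesis
    by (intro conjI bdl_iso_trans[OF bdl_iso_sym[OF L_meet_join_iso_strip_coproduct]]
        L_meet_join_iso_strip_coproduct L_meet_join_iso_Att_coproduct)
qed

end
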